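(* Let $f:\mathbb{R}^n\to\mathbb{R}\cup\{\infty\}$ and $g:\mathbb{R}^m\to\mathbb{R}$ be proper, convex, closed functions, let $g$ be $L_g$-smooth, let $A\in\mathbb{R}^{m\times n}$, and let $\epsilon>0$ be arbitrary. For step sizes $\tau,\sigma>0$ consider the iteration (semi-implicit primal-dual method) $$x^{k+1}=\operatorname{prox}_{\tau f}(x^k-\tau A^\top y^k),\qquad y^{k+1}=y^k-\sigma\big(\nabla g(y^k)-A(2x^{k+1}-x^k)\big).$$ Then the fixed points of this iteration coincide with the solutions of $\min_x\max_y f(x)+y^\top Ax-g(y)$. Furthermore: (i) If $\tau\sigma\|A\|^2+\frac{L_g}{2}\sigma<1$ and either (C1) or (C2) holds, then the iteration is contractive in $\|\cdot\|_{\Psi_{\tau,\sigma}}$ with rate $\rho$, where $$\Psi_{\tau,\sigma}=\Phi_{\tau,\sigma}+\operatorname{diag}(\gamma_xI_n,0)\succ0,\qquad \rho=\sqrt{1-\frac{\min\{\gamma_x,\gamma_y\}}{\zeta_{\tau,\sigma}+\gamma_x}}<1 .$$ (ii) If $\tau\sigma\|A\|^2+\frac{L_g}{2}\sigma\le1$, $\tau\sigma\|A\|^2(1+\epsilon)^2\le1$ and (C3) holds, then the iteration is contractive in $\|\cdot\|_{\Phi_{\tau,\sigma}}$ with rate $$\rho=\frac{R_3'\,\zeta_{\tau,\sigma}}{\sqrt{(R_3')^2\zeta_{\tau,\sigma}^2+1}}<1,$$ where $R_3'>0$ is a constant independent of $\sigma$ and $\tau$. Among all $\tau,\sigma>0$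 satisfying these two step-size conditions, the best (smallest) rate $\rho$ is obtained with $$\tau=\sigma=\min\left\{\frac{\sqrt{L_g^2+16\|A\|^2}-L_g}{4\|A\|^2},\ \frac{1}{(1+\epsilon)\|A\|}\right\}.$$
   Context: Conditions: (C1) $f$ is $\mu_f$-strongly convex and $g$ is $\mu_g$-strongly convex, $\mu_f>0$, $\mu_g>0$. (C2) $g$ is $\mu_g$-strongly convex and $L_g$-smooth, $\mu_g>0$, $L_g>0$; and $\lambda_{\min}(A^\top A)>0$. (C3) $f$ is $L_f$-smooth, $g$ is $L_g$-smooth, $L_f,L_g\ge0$; $n=m$ and $\lambda_{\min}(A^\top A)=\lambda_{\min}(AA^\top)>0$. Here $L$-smooth means finite, differentiable with $L$-Lipschitz gradient. Throughout $\mu_A=\lambda_{\min}(A^\top A)\ge0$, and $\mu_f\ge0$ is a strong convexity modulus of $f$ ($\mu_f=0$ if $f$ is merely convex). A solution of the saddle-point problem is a pair $(x^\star,y^\star)\in\operatorname{dom}f\times\operatorname{dom}g$ with $f(x^\star)+y^\top Ax^\star-g(y)\le f(x^\star)+(y^\star)^\top Ax^\star-g(y^\star)\le f(x)+(y^\star)^\top Ax-g(y^\star)$ for all $x\in\operatorname{dom}f$, $y\in\operatorname{dom}g$; equivalently $0\in\partial f(x^\star)+A^\top y^\star$ and $0\in\partial g(y^\star)-Ax^\star$. $\operatorname{prox}_\psi(u)=\operatorname{argmin}_{z}\{\psi(z)+\frac12\|u-z\|^2\}$. $\|\cdot\|$ is the Euclidean norm on vectors and spectral norm on matrices; $\|u\|_\Phi^2=u^\top\Phi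 u$. A map $\mathcal A$ (and the iteration $\omega^{k+1}=\mathcal A(\omega^k)$) is contractive in $\|\cdot\|_\Phi$ ($\Phi\succ0$) with rate $\rho\in[0,1)$ if $\|\mathcal A(\omega)-\mathcal A(\omega')\|_\Phi\le\rho\|\omega-\omega'\|_\Phi$ for all $\omega,\omega'$. $$\Phi_{\tau,\sigma}=\begin{bmatrix}\frac1\tau I_n&-A^\top\\-A&\frac1\sigma I_m\end{bmatrix},\quad \zeta_{\tau,\sigma}=\max\{\tfrac1\tau,\tfrac1\sigma\}+\|A\|,\quad \gamma_x=\frac{\mu_A}{\zeta_{\tau,\sigma}}+2\mu_f,$$ and, with $\xi_1=\frac1\sigma-\tau\|A\|^2$, $\xi_2=\frac1\sigma-\tau\mu_A$, $$\gamma_y=\begin{cases}\frac{2L_g\mu_g}{L_g+\mu_g}+\frac{\mu_g^2(2\xi_1-L_g-\mu_g)}{(L_g+\mu_g)\xi_2}&\text{if }\xi_1\ge\frac{L_g+\mu_g}{2},\\[2pt]\frac{2L_g\mu_g}{L_g+\mu_g}-\frac{L_g^2(L_g+\mu_g-2\xi_1)}{(L_g+\mu_g)\xi_1}&\text{if }\xi_1<\frac{L_g+\mu_g}{2}.\end{cases}$$ *)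

theory Defs
  imports "HOL-Analysis.Analysis"
begin

section \<open>Extended-valued convex functions\<close>

definition effective_domain :: "('a \<Rightarrow> ereal) \<Rightarrow> 'a set" where
  "effective_domain f = {x. f x < \<infinity>}"

definition proper_fun :: "('a \<Rightarrow> ereal) \<Rightarrow> bool" where
  "proper_fun f \<longleftrightarrow> (\<forall>x. f x \<noteq> -\<infinity>) \<and> effective_domain f \<noteq> {}"

definition closed_fun :: "('a::euclidean_space \<Rightarrow> ereal) \<Rightarrow> bool" where
  "closed_fun f \<longleftrightarrow> closed {(x, r :: real). f x \<le> ereal r}"

text \<open>These inequalities are meant for functions that never take the value \<open>-\<infinity>\<close>, so that no sum
  \<open>\<infinity> + -\<infinity>\<close> arises. The library convention \<open>0 * \<infinity> = 0\<close> makes the cases \<open>u = 0\<close> and \<open>v = 0\<close> trivial.\<close>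

definition convex_fun :: "('a::euclidean_space \<Rightarrow> ereal) \<Rightarrow> bool" where
  "convex_fun f \<longleftrightarrow> (\<forall>x y. \<forall>u\<ge>0. \<forall>v\<ge>0. u + v = 1 \<longrightarrow>
     f (u *\<^sub>R x + v *\<^sub>R y) \<le> ereal u * f x + ereal v * f y)"

definition strongly_convex_fun :: "real \<Rightarrow> ('a::euclidean_space \<Rightarrow> ereal) \<Rightarrow> bool" where
  "strongly_convex_fun \<mu> f \<longleftrightarrow> (\<forall>x y. \<forall>u\<ge>0. \<forall>v\<ge>0. u + v = 1 \<longrightarrow>
     f (u *\<^sub>R x + v *\<^sub>R y) + ereal (\<mu> / 2 * u * v * (norm (x - y))\<^sup>2)
       \<le> ereal u * f x + ereal v * f y)"

definition gradient :: "('a::euclidean_space \<Rightarrow> real) \<Rightarrow> 'a \<Rightarrow> 'a" where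
  "gradient h x = (THE D. GDERIV h x :> D)"

text \<open>\<^const>\<open>lipschitz_on\<close> includes \<open>0 \<le> L\<close>.\<close>

definition smooth_fun :: "real \<Rightarrow> ('a::euclidean_space \<Rightarrow> ereal) \<Rightarrow> bool" where
  "smooth_fun L f \<longleftrightarrow>
     (\<forall>x. \<bar>f x\<bar> \<noteq> \<infinity>) \<and>
     (\<forall>x. (\<lambda>z. real_of_ereal (f z)) differentiable (at x)) \<and>
     lipschitz_on L UNIV (gradient (\<lambda>z. real_of_ereal (f z)))"

text \<open>If \<open>\<psi>\<close> is proper, closed and convex, the minimizer exists and is unique, so the
  choice made by \<^const>\<open>arg_min\<close> is immaterial.\<close>

definition prox :: "('a::euclidean_space \<Rightarrow> ereal) \<Rightarrow> 'a \<Rightarrow> 'a" where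
  "prox \<psi> u = arg_min (\<lambda>z. \<psi> z + ereal (1 / 2 * (norm (u - z))\<^sup>2)) (\<lambda>_. True)"

section \<open>Matrices and weighted norms\<close>

definition spectral_norm :: "real^'n^'m \<Rightarrow> real" where
  "spectral_norm A = onorm ((*v) A)"

text \<open>Smallest eigenvalue; used for symmetric matrices only.\<close>

definition lambda_min :: "real^'n^'n \<Rightarrow> real" where
  "lambda_min M = (LEAST l. \<exists>v. v \<noteq> 0 \<and> M *v v = l *\<^sub>R v)"

definition mu_A :: "real^'n^'m \<Rightarrow> real" where
  "mu_A A = lambda_min (transpose A ** A)"

text \<open>The block matrix \<open>[P Q; R S]\<close>, as an operator on pairs.\<close>

definition block_op :: "real^'n^'n \<Rightarrow> real^'m^'n \<Rightarrow> real^'n^'m \<Rightarrow> real^'m^'m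
    \<Rightarrow> (real^'n) \<times> (real^'m) \<Rightarrow> (real^'n) \<times> (real^'m)" where
  "block_op P Q R S = (\<lambda>(x, y). (P *v x + Q *v y, R *v x + S *v y))"

definition pos_def_op :: "('a::euclidean_space \<Rightarrow> 'a) \<Rightarrow> bool" where
  "pos_def_op \<Phi> \<longleftrightarrow> linear \<Phi> \<and> (\<forall>u v. u \<bullet> \<Phi> v = \<Phi> u \<bullet> v) \<and> (\<forall>u. u \<noteq> 0 \<longrightarrow> u \<bullet> \<Phi> u > 0)"

definition weighted_norm :: "('a::euclidean_space \<Rightarrow> 'a) \<Rightarrow> 'a \<Rightarrow> real" where
  "weighted_norm \<Phi> u = sqrt (u \<bullet> \<Phi> u)"

definition contractive_in :: "('a::euclidean_space \<Rightarrow> 'a) \<Rightarrow> real \<Rightarrow> ('a \<Rightarrow> 'a) \<Rightarrow> bool" where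
  "contractive_in \<Phi> \<rho> T \<longleftrightarrow> pos_def_op \<Phi> \<and> 0 \<le> \<rho> \<and> \<rho> < 1 \<and>
     (\<forall>w w'. weighted_norm \<Phi> (T w - T w') \<le> \<rho> * weighted_norm \<Phi> (w - w'))"

section \<open>The saddle-point problem and the semi-implicit primal-dual method\<close>

definition lagrangian :: "(real^'n \<Rightarrow> ereal) \<Rightarrow> (real^'m \<Rightarrow> ereal) \<Rightarrow> real^'n^'m
    \<Rightarrow> real^'n \<Rightarrow> real^'m \<Rightarrow> ereal" where
  "lagrangian f g A x y = f x + ereal (y \<bullet> (A *v x)) - g y"

definition saddle_solution :: "(real^'n \<Rightarrow> ereal) \<Rightarrow> (real^'m \<Rightarrow> ereal) \<Rightarrow> real^'n^'m
    \<Rightarrow> real^'n \<Rightarrow> real^'m \<Rightarrow> bool" where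
  "saddle_solution f g A xs ys \<longleftrightarrow>
     xs \<in> effective_domain f \<and> ys \<in> effective_domain g \<and>
     (\<forall>x\<in>effective_domain f. \<forall>y\<in>effective_domain g.
        lagrangian f g A xs y \<le> lagrangian f g A xs ys \<and>
        lagrangian f g A xs ys \<le> lagrangian f g A x ys)"

definition sipd_step :: "(real^'n \<Rightarrow> ereal) \<Rightarrow> (real^'m \<Rightarrow> real) \<Rightarrow> real^'n^'m \<Rightarrow> real \<Rightarrow> real
    \<Rightarrow> (real^'n) \<times> (real^'m) \<Rightarrow> (real^'n) \<times> (real^'m)" where
  "sipd_step f g A \<tau> \<sigma> = (\<lambda>(x, y).
     let x' = prox (\<lambda>z. ereal \<tau> * f z) (x - \<tau> *\<^sub>R (transpose A *v y))
     in (x', y - \<sigma> *\<^sub>R (gradient g y - A *v (2 *\<^sub>R x' - x))))"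

definition cond_C1 :: "(real^'n \<Rightarrow> ereal) \<Rightarrow> (real^'m \<Rightarrow> real) \<Rightarrow> real \<Rightarrow> real \<Rightarrow> bool" where
  "cond_C1 f g \<mu>f \<mu>g \<longleftrightarrow>
     strongly_convex_fun \<mu>f f \<and> strongly_convex_fun \<mu>g (\<lambda>y. ereal (g y)) \<and> \<mu>f > 0 \<and> \<mu>g > 0"

definition cond_C2 :: "(real^'m \<Rightarrow> real) \<Rightarrow> real^'n^'m \<Rightarrow> real \<Rightarrow> real \<Rightarrow> bool" where
  "cond_C2 g A \<mu>g Lg \<longleftrightarrow>
     strongly_convex_fun \<mu>g (\<lambda>y. ereal (g y)) \<and> smooth_fun Lg (\<lambda>y. ereal (g y)) \<and>
     \<mu>g > 0 \<and> Lg > 0 \<and> lambda_min (transpose A ** A) > 0"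

definition cond_C3 :: "(real^'n \<Rightarrow> ereal) \<Rightarrow> (real^'m \<Rightarrow> real) \<Rightarrow> real^'n^'m
    \<Rightarrow> real \<Rightarrow> real \<Rightarrow> bool" where
  "cond_C3 f g A Lf Lg \<longleftrightarrow>
     smooth_fun Lf f \<and> smooth_fun Lg (\<lambda>y. ereal (g y)) \<and> Lf \<ge> 0 \<and> Lg \<ge> 0 \<and>
     CARD('n) = CARD('m) \<and>
     lambda_min (transpose A ** A) = lambda_min (A ** transpose A) \<and>
     lambda_min (transpose A ** A) > 0"

definition Phi :: "real^'n^'m \<Rightarrow> real \<Rightarrow> real
    \<Rightarrow> (real^'n) \<times> (real^'m) \<Rightarrow> (real^'n) \<times> (real^'m)" where
  "Phi A \<tau> \<sigma> = block_op (mat (1 / \<tau>)) (- transpose A) (- A) (mat (1 / \<sigma>))"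

definition zeta :: "real^'n^'m \<Rightarrow> real \<Rightarrow> real \<Rightarrow> real" where
  "zeta A \<tau> \<sigma> = max (1 / \<tau>) (1 / \<sigma>) + spectral_norm A"

definition gamma_x :: "real^'n^'m \<Rightarrow> real \<Rightarrow> real \<Rightarrow> real \<Rightarrow> real" where
  "gamma_x A \<mu>f \<tau> \<sigma> = mu_A A / zeta A \<tau> \<sigma> + 2 * \<mu>f"

definition gamma_y :: "real^'n^'m \<Rightarrow> real \<Rightarrow> real \<Rightarrow> real \<Rightarrow> real \<Rightarrow> real" where
  "gamma_y A \<mu>g Lg \<tau> \<sigma> =
     (let \<xi>1 = 1 / \<sigma> - \<tau> * (spectral_norm A)\<^sup>2;
          \<xi>2 = 1 / \<sigma> - \<tau> * mu_A A
      in if \<xi>1 \<ge> (Lg + \<mu>g) / 2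
         then 2 * Lg * \<mu>g / (Lg + \<mu>g) + \<mu>g\<^sup>2 * (2 * \<xi>1 - Lg - \<mu>g) / ((Lg + \<mu>g) * \<xi>2)
         else 2 * Lg * \<mu>g / (Lg + \<mu>g) - Lg\<^sup>2 * (Lg + \<mu>g - 2 * \<xi>1) / ((Lg + \<mu>g) * \<xi>1))"

definition Psi :: "real^'n^'m \<Rightarrow> real \<Rightarrow> real \<Rightarrow> real
    \<Rightarrow> (real^'n) \<times> (real^'m) \<Rightarrow> (real^'n) \<times> (real^'m)" where
  "Psi A \<mu>f \<tau> \<sigma> = (\<lambda>w. Phi A \<tau> \<sigma> w + block_op (mat (gamma_x A \<mu>f \<tau> \<sigma>)) 0 0 0 w)"

definition rate_strong :: "real^'n^'m \<Rightarrow> real \<Rightarrow> real \<Rightarrow> real \<Rightarrow> real \<Rightarrow> real \<Rightarrow> real" where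
  "rate_strong A \<mu>f \<mu>g Lg \<tau> \<sigma> =
     sqrt (1 - min (gamma_x A \<mu>f \<tau> \<sigma>) (gamma_y A \<mu>g Lg \<tau> \<sigma>) / (zeta A \<tau> \<sigma> + gamma_x A \<mu>f \<tau> \<sigma>))"

definition rate_smooth :: "real \<Rightarrow> real^'n^'m \<Rightarrow> real \<Rightarrow> real \<Rightarrow> real" where
  "rate_smooth R A \<tau> \<sigma> = R * zeta A \<tau> \<sigma> / sqrt (R\<^sup>2 * (zeta A \<tau> \<sigma>)\<^sup>2 + 1)"

definition admissible_smooth :: "real^'n^'m \<Rightarrow> real \<Rightarrow> real \<Rightarrow> real \<Rightarrow> real \<Rightarrow> bool" where
  "admissible_smooth A Lg \<epsilon> \<tau> \<sigma> \<longleftrightarrow>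
     \<tau> > 0 \<and> \<sigma> > 0 \<and>
     \<tau> * \<sigma> * (spectral_norm A)\<^sup>2 + Lg / 2 * \<sigma> \<le> 1 \<and>
     \<tau> * \<sigma> * (spectral_norm A)\<^sup>2 * (1 + \<epsilon>)\<^sup>2 \<le> 1"

definition best_step :: "real^'n^'m \<Rightarrow> real \<Rightarrow> real \<Rightarrow> real" where
  "best_step A Lg \<epsilon> =
     min ((sqrt (Lg\<^sup>2 + 16 * (spectral_norm A)\<^sup>2) - Lg) / (4 * (spectral_norm A)\<^sup>2))
         (1 / ((1 + \<epsilon>) * spectral_norm A))"

end

theory Submission
  imports Defs
begin

text \<open>For two runs of the iteration write \<open>a, a'\<close> and \<open>b, b'\<close> for the differences of the old and new \<open>x\<close>
  and \<open>y\<close> components, \<open>h\<close> for the difference of the gradients of \<open>g\<close> at the old \<open>y\<close>, and \<open>p\<close> for the difference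
  of the subgradients of \<open>f\<close> selected by the prox. The operator \<open>\<Phi>\<close> maps \<open>(a - a', b - b')\<close> to
  \<open>(p + A\<^sup>T b', h - A a')\<close>. The explicit gradient is absorbed by the vector \<open>e\<close> with \<open>\<Phi> e = (0, h)\<close>:
  completing the square around \<open>e\<close> costs at most \<open>\<parallel>h\<parallel>\<^sup>2 / \<xi>\<close> with \<open>\<xi> = 1/\<sigma> - \<tau> \<parallel>A\<parallel>\<^sup>2\<close>, which cocoercivity of
  the gradient of \<open>g\<close> pays for, and the remaining square is at least
  \<open>(\<parallel>p + A\<^sup>T b'\<parallel>\<^sup>2 + \<parallel>A a'\<parallel>\<^sup>2) / \<zeta>\<close>. In case (i) the \<open>A a'\<close> part contributes to \<open>\<gamma>\<^sub>x\<close>; in case (ii) smoothness of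
  \<open>f\<close> bounds \<open>p\<close> by \<open>a'\<close>, so these two terms control both \<open>a'\<close> and \<open>b'\<close>. The rate in (ii) increases with
  \<open>\<zeta>\<close>, hence is optimal when \<open>min \<tau> \<sigma>\<close> is as large as the constraints allow.\<close>

section \<open>Smooth and strongly convex functions\<close>

text \<open>Letting \<open>t\<close> tend to 0 from the right removes the perturbation. In
  \<open>prox_subgradient\<close> this discards the second-order part of a variation along a
  segment.\<close>

lemma nonneg_if_nonneg_perturbed:
  fixes \<alpha> \<beta> :: real
  assumes "\<And>t. 0 < t \<Longrightarrow> t < 1 \<Longrightarrow> 0 \<le> \<alpha> + t * \<beta>"
  shows "0 \<le> \<alpha>"
proof (rule tendsto_lowerbound)
  have "((\<lambda>t. \<alpha> + t * \<beta>) \<longlongrightarrow> \<alpha> + 0 * \<beta>) (at_right 0)"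
    by (intro tendsto_intros)
  then show "((\<lambda>t. \<alpha> + t * \<beta>) \<longlongrightarrow> \<alpha>) (at_right 0)" by simp
  show "\<forall>\<^sub>F t in at_right 0. 0 \<le> \<alpha> + t * \<beta>"
    using assms unfolding eventually_at_right_field by (intro exI[of _ 1]) auto
qed simp

lemma GDERIV_unique:
  assumes "GDERIV h x :> D" "GDERIV h x :> E"
  shows "D = E"
proof -
  have "(\<lambda>v. v \<bullet> D) = (\<lambda>v. v \<bullet> E)"
    using assms has_derivative_unique unfolding gderiv_def by blast
  then show ?thesis
    by (metis inner_commute vector_eq_rdot)
qed

lemma gradient_eq: "GDERIV h x :> D \<Longrightarrow> gradient h x = D"
  unfolding gradient_def using GDERIV_unique by blast

text \<open>The derivative is a linear functional whose Riesz vector is its adjoint applied to 1.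
  Hence the definite description in \<open>gradient\<close> denotes the actual gradient wherever the
  function is differentiable.\<close>

lemma differentiable_imp_GDERIV_gradient:
  assumes "h differentiable (at x)"
  shows "GDERIV h x :> gradient h x"
proof -
  obtain h' where h': "(h has_derivative h') (at x)"
    using assms unfolding differentiable_def by blast
  have lin: "linear h'"
    using h' has_derivative_linear by blast
  have "h' = (\<lambda>v. v \<bullet> adjoint h' 1)"
    using adjoint_works[OF lin] by (auto simp: fun_eq_iff inner_commute)
  then have "GDERIV h x :> adjoint h' 1"
    using h' unfolding gderiv_def by metis
  then show ?thesis
    using gradient_eq by metis
qed

lemma GDERIV_along_line:
  assumes "GDERIV F (x + t *\<^sub>R d) :> D"
  shows "((\<lambda>t. F (x + t *\<^sub>R d)) has_real_derivative d \<bullet> D) (at t)"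
proof -
  have "((\<lambda>t. F (x + t *\<^sub>R d)) has_derivative (\<lambda>s. (s *\<^sub>R d) \<bullet> D)) (at t)"
    using assms unfolding gderiv_def
    by (intro has_derivative_compose[of "\<lambda>t. x + t *\<^sub>R d" "\<lambda>s. s *\<^sub>R d" t UNIV F "\<lambda>h. h \<bullet> D"])
      (auto intro!: derivative_eq_intros)
  then show ?thesis
    by (simp add: has_field_derivative_def mult_commute_abs)
qed

section \<open>Quadratic upper and lower models\<close>

text \<open>Along the segment from \<open>x\<close> to \<open>z\<close>, the function minus its
  quadratic model has nonpositive derivative, by Cauchy-Schwarz and the Lipschitz bound. This
  monotonicity argument replaces the usual integral of the gradient.\<close>

lemma smooth_upper_bound:
  assumes G: "\<And>x. GDERIV F x :> G x" and lip: "L-lipschitz_on UNIV G"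
  shows "F z \<le> F x + G x \<bullet> (z - x) + L / 2 * (norm (z - x))\<^sup>2"
proof -
  define d where "d = z - x"
  define \<psi> where "\<psi> t = F (x + t *\<^sub>R d) - t * (d \<bullet> G x) - L * t\<^sup>2 / 2 * (norm d)\<^sup>2" for t
  have "\<psi> 1 \<le> \<psi> 0"
  proof (rule DERIV_nonpos_imp_nonincreasing[of 0 1 \<psi>])
    fix t :: real assume t: "0 \<le> t" "t \<le> 1"
    have "(\<psi> has_real_derivative d \<bullet> G (x + t *\<^sub>R d) - d \<bullet> G x - L * t * (norm d)\<^sup>2) (at t)"
      unfolding \<psi>_def
      by (auto intro!: derivative_eq_intros GDERIV_along_line[OF G])
    moreover have "d \<bullet> (G (x + t *\<^sub>R d) - G x) \<le> norm d * (L * norm (t *\<^sub>R d))"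
      using lipschitz_on_normD[OF lip, of "x + t *\<^sub>R d" x]
      by (intro order_trans[OF norm_cauchy_schwarz] mult_left_mono) auto
    then have "d \<bullet> G (x + t *\<^sub>R d) - d \<bullet> G x - L * t * (norm d)\<^sup>2 \<le> 0"
      using t by (simp add: inner_diff_right power2_eq_square algebra_simps)
    ultimately show "\<exists>y. (\<psi> has_real_derivative y) (at t) \<and> y \<le> 0" by blast
  qed simp
  then show ?thesis
    by (simp add: \<psi>_def d_def inner_commute)
qed

lemma real_of_ereal_of_domain:
  assumes "proper_fun f" "x \<in> effective_domain f"
  shows "ereal (real_of_ereal (f x)) = f x"
  using assms by (cases "f x") (auto simp: proper_fun_def effective_domain_def)

text \<open>Moves the extended-valued inequality to the reals once and for all: the finite
  right-hand side excludes infinity at the intermediate point, and properness excludes minus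
  infinity.\<close>

lemma strongly_convex_real:
  fixes f :: "'a::euclidean_space \<Rightarrow> ereal"
  defines "F \<equiv> \<lambda>x. real_of_ereal (f x)"
  assumes sc: "strongly_convex_fun \<mu> f" and f: "proper_fun f"
    and x: "x \<in> effective_domain f" and z: "z \<in> effective_domain f" and t: "0 \<le> t" "t \<le> 1"
  shows "x + t *\<^sub>R (z - x) \<in> effective_domain f"
    and "F (x + t *\<^sub>R (z - x)) \<le> (1 - t) * F x + t * F z - \<mu> / 2 * (1 - t) * t * (norm (z - x))\<^sup>2"
proof -
  have "(1 - t) *\<^sub>R x + t *\<^sub>R z = x + t *\<^sub>R (z - x)"
    by (simp add: algebra_simps)
  then have *: "f (x + t *\<^sub>R (z - x)) + ereal (\<mu> / 2 * (1 - t) * t * (norm (z - x))\<^sup>2)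
    \<le> ereal (1 - t) * f x + ereal t * f z"
    using sc[unfolded strongly_convex_fun_def, rule_format, of "1 - t" t x z] t
    by (simp add: norm_minus_commute)
  have fx: "f x = ereal (F x)" and fz: "f z = ereal (F z)"
    unfolding F_def using real_of_ereal_of_domain[OF f] x z by simp_all
  have "f (x + t *\<^sub>R (z - x)) \<noteq> -\<infinity>"
    using f by (simp add: proper_fun_def)
  then obtain r where r: "f (x + t *\<^sub>R (z - x)) = ereal r"
    using * by (cases "f (x + t *\<^sub>R (z - x))") (auto simp: fx fz)
  then have "F (x + t *\<^sub>R (z - x)) = r" by (simp add: F_def)
  then show "x + t *\<^sub>R (z - x) \<in> effective_domain f"
    and "F (x + t *\<^sub>R (z - x)) \<le> (1 - t) * F x + t * F z - \<mu> / 2 * (1 - t) * t * (norm (z - x))\<^sup>2"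
    using * r by (auto simp: fx fz effective_domain_def)
qed

text \<open>Strong convexity on the segment, divided by \<open>t\<close>, bounds the difference
  quotient; the limit from the right is the first-order inequality. Modulus 0 gives the gradient
  inequality of convex functions.\<close>

lemma strongly_convex_lower_bound:
  assumes sc: "strongly_convex_fun \<mu> (\<lambda>y. ereal (F y))" and G: "GDERIV F x :> D"
  shows "F x + D \<bullet> (z - x) + \<mu> / 2 * (norm (z - x))\<^sup>2 \<le> F z"
proof -
  define d where "d = z - x"
  have "((\<lambda>t. F (x + t *\<^sub>R d)) has_real_derivative d \<bullet> D) (at 0)"
    using GDERIV_along_line[of F x 0 d] G by simp
  then have lim: "((\<lambda>t. (F (x + t *\<^sub>R d) - F x) / t) \<longlongrightarrow> d \<bullet> D) (at_right 0)"
    unfolding DERIV_def by (auto intro: filterlim_at_split[THEN iffD1, THEN conjunct2])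
  have lim': "((\<lambda>t. F z - F x - \<mu> / 2 * (1 - t) * (norm d)\<^sup>2) \<longlongrightarrow> F z - F x - \<mu> / 2 * (1 - 0) * (norm d)\<^sup>2) (at_right 0)"
    by (intro tendsto_intros)
  have "d \<bullet> D \<le> F z - F x - \<mu> / 2 * (1 - 0) * (norm d)\<^sup>2"
  proof (rule tendsto_le[OF _ lim' lim])
    have "(F (x + t *\<^sub>R d) - F x) / t \<le> F z - F x - \<mu> / 2 * (1 - t) * (norm d)\<^sup>2"
      if t: "0 < t" "t < 1" for t
    proof -
      have "proper_fun (\<lambda>y. ereal (F y))" "x \<in> effective_domain (\<lambda>y. ereal (F y))"
        "z \<in> effective_domain (\<lambda>y. ereal (F y))"
        by (auto simp: proper_fun_def effective_domain_def)
      from strongly_convex_real(2)[OF sc this, of t] t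
      have "F (x + t *\<^sub>R d) - F x \<le> t * (F z - F x - \<mu> / 2 * (1 - t) * (norm d)\<^sup>2)"
        by (simp add: d_def algebra_simps)
      then show ?thesis
        using t by (simp add: pos_divide_le_eq mult.commute)
    qed
    then show "\<forall>\<^sub>F t in at_right 0. (F (x + t *\<^sub>R d) - F x) / t
        \<le> F z - F x - \<mu> / 2 * (1 - t) * (norm d)\<^sup>2"
      unfolding eventually_at_right_field by (intro exI[of _ 1]) auto
  qed simp
  then show ?thesis
    by (simp add: d_def inner_commute)
qed

section \<open>Cocoercivity of gradients\<close>

text \<open>The Baillon-Haddad argument: a strengthened lower bound is proved for each ordered pair
  of points, and the bounds for \<open>(x, y)\<close> and \<open>(y, x)\<close> are added. The
  hypotheses are the two models, so that the lemma can be applied to a function from which a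
  quadratic has been subtracted.\<close>

lemma cocoercive_bound:
  fixes F :: "'a::real_inner \<Rightarrow> real"
  assumes up: "\<And>x z. F z \<le> F x + G x \<bullet> (z - x) + M / 2 * (norm (z - x))\<^sup>2"
    and low: "\<And>x z. F x + G x \<bullet> (z - x) \<le> F z" and M: "M > 0"
  shows "(norm (G x - G y))\<^sup>2 / M \<le> (G x - G y) \<bullet> (x - y)"
proof -
  have *: "F x + G x \<bullet> (y - x) + (norm (G x - G y))\<^sup>2 / (2 * M) \<le> F y" for x y
  proof -
    define h where "h = G y - G x"
    \<comment> \<open>\<open>z\<close> minimizes the quadratic upper model at \<open>y\<close> minus the affine lower model at \<open>x\<close>.\<close>
    define z where "z = y - (1 / M) *\<^sub>R h"
    have "F x + G x \<bullet> (z - x) \<le> F y + G y \<bullet> (z - y) + M / 2 * (norm (z - y))\<^sup>2"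
      using up[of z y] low[of x z] by linarith
    moreover have "G x \<bullet> (z - x) = G x \<bullet> (y - x) - (1 / M) * (G x \<bullet> h)"
      "G y \<bullet> (z - y) = - (1 / M) * (G y \<bullet> h)"
      by (simp_all add: z_def inner_diff_right)
    moreover have "M / 2 * (norm (z - y))\<^sup>2 = (norm h)\<^sup>2 / (2 * M)"
      using M by (simp add: z_def power2_eq_square field_simps)
    moreover have "G y \<bullet> h - G x \<bullet> h = (norm h)\<^sup>2"
      by (simp add: h_def power2_norm_eq_inner inner_diff_left)
    then have "(1 / M) * (G y \<bullet> h) - (1 / M) * (G x \<bullet> h) = 2 * ((norm h)\<^sup>2 / (2 * M))"
      using M by (simp add: field_simps)
    ultimately show ?thesis
      by (simp add: h_def norm_minus_commute)
  qed
  have "2 * ((norm (G x - G y))\<^sup>2 / (2 * M)) = (norm (G x - G y))\<^sup>2 / M"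
    by simp
  then show ?thesis
    using *[of x y] *[of y x] by (simp add: norm_minus_commute inner_diff_left inner_diff_right)
qed

text \<open>Subtracting \<open>\<mu> / 2\<close> times the squared norm leaves a convex function
  whose upper model has constant \<open>L - \<mu>\<close>. Its cocoercivity, expanded in terms of
  \<open>h\<close> and \<open>b\<close>, is the claim.\<close>

lemma strongly_convex_smooth_cocoercive:
  fixes F :: "'a::real_inner \<Rightarrow> real"
  assumes up: "\<And>x z. F z \<le> F x + G x \<bullet> (z - x) + L / 2 * (norm (z - x))\<^sup>2"
    and low: "\<And>x z. F x + G x \<bullet> (z - x) + \<mu> / 2 * (norm (z - x))\<^sup>2 \<le> F z"
    and lip: "\<And>x y. norm (G x - G y) \<le> L * norm (x - y)"
    and \<mu>: "0 \<le> \<mu>" "\<mu> \<le> L" "L > 0"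
  shows "L * \<mu> / (L + \<mu>) * (norm (x - y))\<^sup>2 + (norm (G x - G y))\<^sup>2 / (L + \<mu>) \<le> (G x - G y) \<bullet> (x - y)"
proof -
  define h where "h = G x - G y"
  define b where "b = x - y"
  have "L * \<mu> * (norm b)\<^sup>2 + (norm h)\<^sup>2 \<le> (L + \<mu>) * (h \<bullet> b)"
  proof (cases "\<mu> = L")
    \<comment> \<open>Here \<open>L - \<mu>\<close> vanishes and cannot be divided by. Strong
      monotonicity bounds both summands instead, the second one through the Lipschitz
      estimate.\<close>
    case True
    have "L * (norm b)\<^sup>2 \<le> h \<bullet> b"
      using low[of x y] low[of y x] True
      by (simp add: h_def b_def inner_diff_left inner_diff_right norm_minus_commute)
    then have "2 * L * (L * (norm b)\<^sup>2) \<le> 2 * L * (h \<bullet> b)"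
      using \<mu> by (intro mult_left_mono) auto
    moreover have "(norm h)\<^sup>2 \<le> (L * norm b)\<^sup>2"
      using lip[of x y] by (intro power_mono) (auto simp: h_def b_def)
    ultimately show ?thesis
      using True by (simp add: power2_eq_square algebra_simps)
  next
    case False
    define M where "M = L - \<mu>"
    have M: "M > 0" using False \<mu> by (simp add: M_def)
    define K where "K z = F z - \<mu> / 2 * (norm z)\<^sup>2" for z
    \<comment> \<open>The exact Taylor expansion of the quadratic carries both models of
      \<open>F\<close> over to \<open>K\<close> by linear arithmetic.\<close>
    have expand: "\<mu> / 2 * (norm z)\<^sup>2 = \<mu> / 2 * (norm x)\<^sup>2 + (\<mu> *\<^sub>R x) \<bullet> (z - x) + \<mu> / 2 * (norm (z - x))\<^sup>2"
      for x z :: 'a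
      by (simp add: power2_norm_eq_inner inner_diff_left inner_diff_right inner_commute algebra_simps)
    have "(norm ((G x - \<mu> *\<^sub>R x) - (G y - \<mu> *\<^sub>R y)))\<^sup>2 / M
      \<le> ((G x - \<mu> *\<^sub>R x) - (G y - \<mu> *\<^sub>R y)) \<bullet> (x - y)"
    proof (rule cocoercive_bound[where F = K, OF _ _ M])
      fix x z
      show "K z \<le> K x + (G x - \<mu> *\<^sub>R x) \<bullet> (z - x) + M / 2 * (norm (z - x))\<^sup>2"
        using up[of z x] expand[of z x] left_diff_distrib[of "L / 2" "\<mu> / 2" "(norm (z - x))\<^sup>2"]
        unfolding K_def M_def inner_diff_left diff_divide_distrib by linarith
      show "K x + (G x - \<mu> *\<^sub>R x) \<bullet> (z - x) \<le> K z"
        using low[of x z] expand[of z x] unfolding K_def inner_diff_left by linarith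
    qed
    moreover have "(G x - \<mu> *\<^sub>R x) - (G y - \<mu> *\<^sub>R y) = h - \<mu> *\<^sub>R b"
      by (simp add: h_def b_def algebra_simps)
    ultimately have "(norm (h - \<mu> *\<^sub>R b))\<^sup>2 \<le> M * ((h - \<mu> *\<^sub>R b) \<bullet> b)"
      using M by (simp add: b_def field_simps)
    moreover have "(norm (h - \<mu> *\<^sub>R b))\<^sup>2 = (norm h)\<^sup>2 - 2 * \<mu> * (h \<bullet> b) + \<mu>\<^sup>2 * (norm b)\<^sup>2"
      unfolding power2_norm_eq_inner
      by (simp add: inner_diff_left inner_diff_right inner_commute power2_eq_square algebra_simps)
    moreover have "(h - \<mu> *\<^sub>R b) \<bullet> b = h \<bullet> b - \<mu> * (norm b)\<^sup>2"
      by (simp add: inner_diff_left power2_norm_eq_inner)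
    ultimately have "(norm h)\<^sup>2 - 2 * \<mu> * (h \<bullet> b) + \<mu>\<^sup>2 * (norm b)\<^sup>2 \<le> M * (h \<bullet> b - \<mu> * (norm b)\<^sup>2)"
      by simp
    then show ?thesis
      by (simp add: M_def power2_eq_square algebra_simps)
  qed
  then have "(L * \<mu> * (norm b)\<^sup>2 + (norm h)\<^sup>2) / (L + \<mu>) \<le> h \<bullet> b"
    using \<mu> by (simp add: pos_divide_le_eq mult.commute)
  then show ?thesis
    by (simp add: h_def b_def add_divide_distrib)
qed

section \<open>Proximal points\<close>

text \<open>Lets the lemmas on strong convexity serve the merely convex case with modulus 0.\<close>

lemma convex_fun_eq_strongly_convex: "convex_fun f \<longleftrightarrow> strongly_convex_fun 0 f"
  by (simp add: convex_fun_def strongly_convex_fun_def)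

lemma convex_epigraph:
  fixes f :: "'a::euclidean_space \<Rightarrow> ereal"
  assumes "convex_fun f"
  shows "convex {(x, r :: real). f x \<le> ereal r}"
proof (rule convexI)
  fix p q :: "'a \<times> real" and u v :: real
  assume p: "p \<in> {(x, r). f x \<le> ereal r}" and q: "q \<in> {(x, r). f x \<le> ereal r}"
    and uv: "0 \<le> u" "0 \<le> v" "u + v = 1"
  obtain x r y s where eq: "p = (x, r)" "q = (y, s)" by fastforce
  have "f (u *\<^sub>R x + v *\<^sub>R y) \<le> ereal u * f x + ereal v * f y"
    using assms uv by (simp add: convex_fun_def)
  also have "\<dots> \<le> ereal u * ereal r + ereal v * ereal s"
    using p q uv eq by (intro add_mono ereal_mult_left_mono) auto
  finally show "u *\<^sub>R p + v *\<^sub>R q \<in> {(x, r). f x \<le> ereal r}"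
    by (simp add: eq)
qed

text \<open>A point one unit below the graph is separated from the closed convex epigraph.
  Comparison with the graph point above it shows that the hyperplane is not vertical, so it can be
  solved for \<open>r\<close>.\<close>

lemma affine_minorant:
  fixes f :: "'a::euclidean_space \<Rightarrow> ereal"
  assumes f: "proper_fun f" "convex_fun f" "closed_fun f"
  obtains \<alpha> p where "\<And>z r. f z \<le> ereal r \<Longrightarrow> \<alpha> + p \<bullet> z \<le> r"
proof -
  obtain z0 where z0: "z0 \<in> effective_domain f"
    using f by (auto simp: proper_fun_def)
  define r0 where "r0 = real_of_ereal (f z0)"
  have r0: "f z0 = ereal r0"
    using real_of_ereal_of_domain[OF f(1) z0] by (simp add: r0_def)
  let ?E = "{(x, r :: real). f x \<le> ereal r}"
  have "(z0, r0 - 1) \<notin> ?E" using r0 by simp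
  from separating_hyperplane_closed_point[OF convex_epigraph[OF f(2)] _ this]
  obtain ab c where ab: "ab \<bullet> (z0, r0 - 1) < c" "\<forall>w\<in>?E. c < ab \<bullet> w"
    using f(3) by (auto simp: closed_fun_def)
  obtain a b where eq: "ab = (a, b)" by fastforce
  have "a \<bullet> z0 + b * (r0 - 1) < c" using ab(1) by (simp add: eq)
  moreover have *: "c < a \<bullet> z + b * r" if "f z \<le> ereal r" for z r
    using ab(2)[rule_format, of "(z, r)"] that by (simp add: eq)
  from *[of z0 r0] r0 have "c < a \<bullet> z0 + b * r0" by simp
  ultimately have b: "b > 0" by (simp add: algebra_simps)
  show thesis
  proof (rule that[of "c / b" "- (1 / b) *\<^sub>R a"])
    fix z r assume "f z \<le> ereal r"
    from *[OF this] have "(c - a \<bullet> z) / b \<le> r"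
      using b by (simp add: pos_divide_le_eq mult.commute)
    then show "c / b + (- (1 / b) *\<^sub>R a) \<bullet> z \<le> r"
      by (simp add: diff_divide_distrib)
  qed
qed

text \<open>The direct method: the affine minorant decreases at most linearly while the proximal
  term grows quadratically, so a sublevel set is bounded, hence compact.\<close>

lemma prox_objective_minimizer_exists:
  fixes f :: "'a::euclidean_space \<Rightarrow> ereal"
  assumes f: "proper_fun f" "convex_fun f" "closed_fun f" and \<tau>: "\<tau> > 0"
  shows "\<exists>z s. f z \<le> ereal s \<and>
    (\<forall>w r. f w \<le> ereal r \<longrightarrow> \<tau> * s + 1 / 2 * (norm (u - z))\<^sup>2 \<le> \<tau> * r + 1 / 2 * (norm (u - w))\<^sup>2)"
proof -
  let ?E = "{(x, r :: real). f x \<le> ereal r}"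
  \<comment> \<open>Minimizing over the closed epigraph instead of the domain avoids any use of semicontinuity.\<close>
  obtain \<alpha> p where minor: "\<And>z r. f z \<le> ereal r \<Longrightarrow> \<alpha> + p \<bullet> z \<le> r"
    using affine_minorant[OF f] by blast
  obtain z0 where z0: "z0 \<in> effective_domain f"
    using f by (auto simp: proper_fun_def)
  define r0 where "r0 = real_of_ereal (f z0)"
  have r0: "f z0 = ereal r0"
    using real_of_ereal_of_domain[OF f(1) z0] by (simp add: r0_def)
  define \<phi> where "\<phi> = (\<lambda>(z, r). \<tau> * r + 1 / 2 * (norm (u - z))\<^sup>2)"
  define c where "c = \<phi> (z0, r0)"
  define S where "S = {w \<in> ?E. \<phi> w \<le> c}"
  have cont: "continuous_on UNIV \<phi>"
    unfolding \<phi>_def split_def by (intro continuous_intros)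
  have "closed S"
  proof -
    have "closed {w. \<phi> w \<le> c}"
      by (intro closed_Collect_le cont continuous_on_const)
    then have "closed (?E \<inter> {w. \<phi> w \<le> c})"
      using f(3) unfolding closed_fun_def by (intro closed_Int)
    moreover have "S = ?E \<inter> {w. \<phi> w \<le> c}"
      unfolding S_def by blast
    ultimately show ?thesis by metis
  qed
  moreover have "bounded S"
  proof -
    \<comment> \<open>Inserting the minorant into the sublevel condition and completing the square
      gives \<open>(s - \<tau> * norm p)\<^sup>2 \<le> K\<close> for the distance \<open>s\<close>
      to \<open>u\<close>. The radius \<open>B\<close> follows because every real number is at most
      1 plus its square.\<close>
    define K where "K = \<bar>2 * (c - \<tau> * \<alpha> - \<tau> * (p \<bullet> u))\<bar> + (\<tau> * norm p)\<^sup>2"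
    define B where "B = \<tau> * norm p + 1 + K"
    have K: "K \<ge> 0" by (simp add: K_def)
    have "S \<subseteq> cball u B \<times> {\<alpha> - norm p * (norm u + B) .. c / \<tau>}"
    proof (rule subrelI)
      fix z r assume "(z, r) \<in> S"
      then have fz: "f z \<le> ereal r" and le: "\<tau> * r + 1 / 2 * (norm (u - z))\<^sup>2 \<le> c"
        by (auto simp: S_def \<phi>_def)
      have r: "\<alpha> + p \<bullet> z \<le> r" by (rule minor[OF fz])
      define s where "s = norm (u - z)"
      have "p \<bullet> (u - z) \<le> norm p * s"
        unfolding s_def by (rule norm_cauchy_schwarz)
      then have "p \<bullet> u - norm p * s \<le> p \<bullet> z"
        by (simp add: inner_diff_right)
      with r have "\<tau> * (\<alpha> + (p \<bullet> u - norm p * s)) \<le> \<tau> * r"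
        using \<tau> by (intro mult_left_mono) auto
      with le have "(s - \<tau> * norm p)\<^sup>2 \<le> K"
        unfolding K_def s_def[symmetric] by (simp add: power2_eq_square algebra_simps)
      moreover have "s - \<tau> * norm p \<le> 1 + (s - \<tau> * norm p)\<^sup>2"
        using self_le_power[of "s - \<tau> * norm p" 2]
        by (cases "1 \<le> s - \<tau> * norm p") (auto intro: order_trans[of _ 1])
      ultimately have sB: "s \<le> B" by (simp add: B_def)
      have "norm z \<le> norm u + B"
        using sB norm_triangle_ineq4[of u "u - z"] by (simp add: s_def)
      then have "norm p * norm z \<le> norm p * (norm u + B)"
        by (intro mult_left_mono) auto
      moreover have "- (norm p * norm z) \<le> p \<bullet> z"
        using Cauchy_Schwarz_ineq2[of p z] by linarith
      ultimately have "\<alpha> - norm p * (norm u + B) \<le> r" using r by linarith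
      moreover have "\<tau> * r \<le> c" using le zero_le_power2[of "norm (u - z)"] by linarith
      then have "r \<le> c / \<tau>" using \<tau> by (simp add: pos_le_divide_eq mult.commute)
      ultimately show "(z, r) \<in> cball u B \<times> {\<alpha> - norm p * (norm u + B) .. c / \<tau>}"
        using sB by (simp add: s_def dist_norm)
    qed
    then show ?thesis
      by (rule bounded_subset[rotated]) (auto intro: bounded_Times)
  qed
  ultimately have "compact S" by (simp add: compact_eq_bounded_closed)
  moreover have z0S: "(z0, r0) \<in> S" by (simp add: S_def c_def r0)
  ultimately obtain w where w: "w \<in> S" "\<forall>v\<in>S. \<phi> w \<le> \<phi> v"
    using continuous_attains_inf[of S \<phi>] continuous_on_subset[OF cont] by blast
  \<comment> \<open>Epigraph points outside \<open>S\<close> have value above \<open>c\<close>, and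
    \<open>w\<close>, being in \<open>S\<close>, has value at most \<open>c\<close>.\<close>
  then have "\<phi> w \<le> \<phi> v" if "v \<in> ?E" for v
    using that w z0S by (cases "\<phi> v \<le> c") (auto simp: S_def)
  moreover obtain z s where "w = (z, s)" by fastforce
  ultimately show ?thesis
    using w(1) by (intro exI[of _ z] exI[of _ s]) (auto simp: S_def \<phi>_def)
qed

text \<open>Existence of a minimizer makes \<open>arg_min\<close> return one. It lies in the domain,
  since outside it the objective is infinite, whereas the minimizer \<open>z\<close> has a finite
  value.\<close>

lemma prox_minimizes:
  fixes f :: "'a::euclidean_space \<Rightarrow> ereal" and u :: 'a
  assumes f: "proper_fun f" "convex_fun f" "closed_fun f" and \<tau>: "\<tau> > 0"
  defines "F \<equiv> \<lambda>x. real_of_ereal (f x)" and "p \<equiv> prox (\<lambda>z. ereal \<tau> * f z) u"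
  shows "p \<in> effective_domain f"
    and "w \<in> effective_domain f \<Longrightarrow>
      \<tau> * F p + 1 / 2 * (norm (u - p))\<^sup>2 \<le> \<tau> * F w + 1 / 2 * (norm (u - w))\<^sup>2"
proof -
  define H where "H = (\<lambda>z. ereal \<tau> * f z + ereal (1 / 2 * (norm (u - z))\<^sup>2))"
  have fle: "f w = ereal (F w)" if "w \<in> effective_domain f" for w
    using real_of_ereal_of_domain[OF f(1) that] by (simp add: F_def)
  have H_dom: "H z = ereal (\<tau> * F z + 1 / 2 * (norm (u - z))\<^sup>2)" if "z \<in> effective_domain f" for z
    by (simp add: H_def fle[OF that])
  have H_inf: "H z = \<infinity>" if "z \<notin> effective_domain f" for z
    using that \<tau> by (auto simp: H_def effective_domain_def)
  obtain z s where z: "f z \<le> ereal s" and min: "\<And>w r. f w \<le> ereal r \<Longrightarrow>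
      \<tau> * s + 1 / 2 * (norm (u - z))\<^sup>2 \<le> \<tau> * r + 1 / 2 * (norm (u - w))\<^sup>2"
    using prox_objective_minimizer_exists[OF f \<tau>] by metis
  have zD: "z \<in> effective_domain f"
    using z by (auto simp: effective_domain_def)
  have "\<tau> * F z \<le> \<tau> * s" using z fle[OF zD] \<tau> by simp
  then have zmin: "H z \<le> H w" for w
    using min[of w "F w"] fle[of w] H_dom[of w] H_dom[OF zD] H_inf[of w]
    by (cases "w \<in> effective_domain f") auto
  have pmin: "H p \<le> H w" for w
    unfolding p_def prox_def H_def[symmetric]
    by (rule arg_minI[where Q = "\<lambda>x. H x \<le> H w"]) (use zmin in \<open>auto simp: not_less\<close>)
  show pD: "p \<in> effective_domain f"
    using pmin[of z] H_inf[of p] H_dom[OF zD] by (cases "p \<in> effective_domain f") auto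
  show "\<tau> * F p + 1 / 2 * (norm (u - p))\<^sup>2 \<le> \<tau> * F w + 1 / 2 * (norm (u - w))\<^sup>2"
    if "w \<in> effective_domain f"
    using pmin[of w] H_dom[OF that] H_dom[OF pD] by simp
qed

text \<open>First-order optimality, tested on the segment from the prox point towards
  \<open>z\<close>: \<open>(u - p) / \<tau>\<close> is a subgradient of \<open>f\<close> at
  \<open>p\<close>, and the modulus of strong convexity survives the limit.\<close>

lemma prox_subgradient:
  fixes f :: "'a::euclidean_space \<Rightarrow> ereal" and u :: 'a
  assumes f: "proper_fun f" "convex_fun f" "closed_fun f" and \<tau>: "\<tau> > 0"
    and sc: "strongly_convex_fun \<mu> f"
  defines "F \<equiv> \<lambda>x. real_of_ereal (f x)" and "p \<equiv> prox (\<lambda>z. ereal \<tau> * f z) u"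
  assumes z: "z \<in> effective_domain f"
  shows "F p + (1 / \<tau>) * ((u - p) \<bullet> (z - p)) + \<mu> / 2 * (norm (z - p))\<^sup>2 \<le> F z"
proof -
  define d where "d = z - p"
  have p: "p \<in> effective_domain f"
    unfolding p_def by (rule prox_minimizes(1)[OF f \<tau>])
  let ?\<alpha> = "\<tau> * (F z - F p) - \<tau> * (\<mu> / 2 * (norm d)\<^sup>2) - (u - p) \<bullet> d"
  have "0 \<le> ?\<alpha>"
  proof (rule nonneg_if_nonneg_perturbed)
    fix t :: real assume t: "0 < t" "t < 1"
    note line = strongly_convex_real[OF sc f(1) p z, of t, folded d_def]
    have "\<tau> * F p + 1 / 2 * (norm (u - p))\<^sup>2
      \<le> \<tau> * F (p + t *\<^sub>R d) + 1 / 2 * (norm (u - (p + t *\<^sub>R d)))\<^sup>2"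
      using prox_minimizes(2)[OF f \<tau> line(1), of u] t by (simp add: F_def p_def)
    moreover have "\<tau> * F (p + t *\<^sub>R d) \<le> \<tau> * ((1 - t) * F p + t * F z - \<mu> / 2 * (1 - t) * t * (norm d)\<^sup>2)"
      using line(2) t \<tau> by (intro mult_left_mono) (auto simp: F_def)
    moreover have "(norm (u - (p + t *\<^sub>R d)))\<^sup>2 = (norm (u - p))\<^sup>2 - 2 * t * ((u - p) \<bullet> d) + t\<^sup>2 * (norm d)\<^sup>2"
      unfolding power2_norm_eq_inner
      by (simp add: inner_diff_left inner_diff_right inner_add_left inner_add_right inner_commute
          power2_eq_square algebra_simps)
    \<comment> \<open>Factors one power of \<open>t\<close> out of the bound for the change of the
      objective, so that division by \<open>t\<close> leaves \<open>?\<alpha>\<close> plus a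
      perturbation of order \<open>t\<close>.\<close>
    moreover have "t * (?\<alpha> + t * (\<tau> * (\<mu> / 2 * (norm d)\<^sup>2) + 1 / 2 * (norm d)\<^sup>2)) =
      \<tau> * ((1 - t) * F p + t * F z - \<mu> / 2 * (1 - t) * t * (norm d)\<^sup>2) - \<tau> * F p
      + (- (2 * t * ((u - p) \<bullet> d)) + t\<^sup>2 * (norm d)\<^sup>2) / 2"
      by (simp add: power2_eq_square field_simps)
    ultimately have "0 \<le> t * (?\<alpha> + t * (\<tau> * (\<mu> / 2 * (norm d)\<^sup>2) + 1 / 2 * (norm d)\<^sup>2))"
      by argo
    then show "0 \<le> ?\<alpha> + t * (\<tau> * (\<mu> / 2 * (norm d)\<^sup>2) + 1 / 2 * (norm d)\<^sup>2)"
      using t by (simp add: zero_le_mult_iff)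
  qed
  then have "\<tau> * (F p + (1 / \<tau>) * ((u - p) \<bullet> d) + \<mu> / 2 * (norm d)\<^sup>2) \<le> \<tau> * F z"
    using \<tau> by (simp add: algebra_simps)
  then show ?thesis
    using \<tau> unfolding d_def by simp
qed

text \<open>For the converse, the subgradient inequalities at \<open>x\<close> and at the prox point
  are tested against each other. Their sum says that the squared distance is at most 0, which also
  gives uniqueness of the minimizer.\<close>

lemma prox_characterization:
  fixes f :: "'a::euclidean_space \<Rightarrow> ereal"
  assumes f: "proper_fun f" "convex_fun f" "closed_fun f" and \<tau>: "\<tau> > 0"
  defines "F \<equiv> \<lambda>x. real_of_ereal (f x)"
  shows "prox (\<lambda>z. ereal \<tau> * f z) u = x \<longleftrightarrow> x \<in> effective_domain f \<and>
    (\<forall>z\<in>effective_domain f. F x + (1 / \<tau>) * ((u - x) \<bullet> (z - x)) \<le> F z)"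
    (is "?p = x \<longleftrightarrow> ?R")
proof
  have sc: "strongly_convex_fun 0 f"
    using f(2) by (simp add: convex_fun_eq_strongly_convex)
  have p: "?p \<in> effective_domain f"
    "\<And>z. z \<in> effective_domain f \<Longrightarrow> F ?p + (1 / \<tau>) * ((u - ?p) \<bullet> (z - ?p)) \<le> F z"
    using prox_minimizes(1)[OF f \<tau>, of u] prox_subgradient[OF f \<tau> sc, of _ u]
    by (simp_all add: F_def)
  { assume "?p = x"
    then show ?R using p by blast }
  assume R: ?R
  have "F x + (1 / \<tau>) * ((u - x) \<bullet> (?p - x)) \<le> F ?p"
    using R p(1) by blast
  moreover have "F ?p + (1 / \<tau>) * ((u - ?p) \<bullet> (x - ?p)) \<le> F x"
    using p(2)[of x] R by simp
  ultimately have "(1 / \<tau>) * ((u - x) \<bullet> (?p - x) + (u - ?p) \<bullet> (x - ?p)) \<le> 0"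
    unfolding distrib_left by linarith
  moreover have "(u - x) \<bullet> (?p - x) + (u - ?p) \<bullet> (x - ?p) = (norm (?p - x))\<^sup>2"
    by (simp add: power2_norm_eq_inner inner_diff_left inner_diff_right inner_commute)
  ultimately have "(norm (?p - x))\<^sup>2 \<le> 0"
    using \<tau> by (simp add: mult_le_0_iff divide_le_0_iff)
  then show "?p = x" by simp
qed

section \<open>The preconditioner\<close>

text \<open>Positive semidefiniteness is tested at \<open>v - (1 / K) *\<^sub>R T v\<close>. Applied
  to \<open>Phi\<close> with \<open>K = \<zeta>\<close>, this turns the quadratic form of a step
  into squared residuals.\<close>

lemma psd_operator_bound:
  fixes T :: "'a::euclidean_space \<Rightarrow> 'a"
  assumes lin: "linear T" and sym: "\<And>u v. u \<bullet> T v = T u \<bullet> v"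
    and psd: "\<And>u. 0 \<le> u \<bullet> T u" and up: "\<And>u. u \<bullet> T u \<le> K * (norm u)\<^sup>2" and K: "K > 0"
  shows "(norm (T v))\<^sup>2 / K \<le> v \<bullet> T v"
proof -
  define c where "c = 1 / K"
  let ?u = "v - c *\<^sub>R T v"
  have "?u \<bullet> T ?u = v \<bullet> T v - 2 * c * (norm (T v))\<^sup>2 + c\<^sup>2 * (T v \<bullet> T (T v))"
    using sym[of v "T v"]
    by (simp add: linear_diff[OF lin] linear_scale[OF lin] inner_diff_left inner_diff_right
        power2_norm_eq_inner power2_eq_square[of c] algebra_simps)
  moreover have "c\<^sup>2 * (T v \<bullet> T (T v)) \<le> c\<^sup>2 * (K * (norm (T v))\<^sup>2)"
    by (intro mult_left_mono up) auto
  moreover have "c\<^sup>2 * (K * (norm (T v))\<^sup>2) = c * (norm (T v))\<^sup>2"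
    using K by (simp add: c_def power2_eq_square)
  ultimately have "c * (norm (T v))\<^sup>2 \<le> v \<bullet> T v"
    using psd[of ?u] by linarith
  then show ?thesis by (simp add: c_def)
qed

text \<open>The preceding bound with a boundedness constant of \<open>T\<close> as \<open>K\<close>
  forces \<open>T v\<close> to vanish. It replaces a Lagrange multiplier argument for
  eigenvectors.\<close>

lemma psd_kernel:
  fixes T :: "'a::euclidean_space \<Rightarrow> 'a"
  assumes lin: "linear T" and sym: "\<And>u v. u \<bullet> T v = T u \<bullet> v"
    and psd: "\<And>u. 0 \<le> u \<bullet> T u" and zero: "v \<bullet> T v = 0"
  shows "T v = 0"
proof -
  obtain K where K: "K > 0" "\<And>u. norm (T u) \<le> norm u * K"
    using bounded_linear.pos_bounded lin linear_conv_bounded_linear by blast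
  have "u \<bullet> T u \<le> K * (norm u)\<^sup>2" for u
  proof -
    have "u \<bullet> T u \<le> norm u * norm (T u)" by (rule norm_cauchy_schwarz)
    also have "\<dots> \<le> norm u * (norm u * K)" by (intro mult_left_mono K) simp
    finally show ?thesis by (simp add: power2_eq_square mult_ac)
  qed
  from psd_operator_bound[OF lin sym psd this K(1), of v] zero K(1) show ?thesis
    by (simp add: divide_le_0_iff)
qed

section \<open>Smallest eigenvalues and Gram matrices\<close>

text \<open>Let \<open>m\<close> be the minimum of the Rayleigh quotient on the unit sphere. Then
  \<open>M - m I\<close> is positive semidefinite and its form vanishes at the minimizer, which is
  therefore an eigenvector. So the \<open>LEAST\<close> in \<open>lambda_min\<close> is attained and
  equals \<open>m\<close>.\<close>

lemma lambda_min_eigenvector: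
  fixes M :: "real^'n^'n"
  assumes M: "transpose M = M"
  shows "\<exists>v. v \<noteq> 0 \<and> M *v v = lambda_min M *\<^sub>R v"
    and "lambda_min M * (norm u)\<^sup>2 \<le> u \<bullet> (M *v u)"
proof -
  have sym: "u \<bullet> (M *v v) = (M *v u) \<bullet> v" for u v
    by (metis M dot_lmul_matrix transpose_matrix_vector)
  have "continuous_on (sphere 0 1) (\<lambda>v::real^'n. v \<bullet> (M *v v))"
    by (intro continuous_intros linear_continuous_on matrix_vector_mul_bounded_linear)
  moreover have "sphere 0 1 \<noteq> ({} :: (real^'n) set)"
    by (simp add: sphere_eq_empty)
  ultimately have "\<exists>v\<in>sphere 0 1. \<forall>w\<in>sphere 0 1. v \<bullet> (M *v v) \<le> w \<bullet> (M *v w)"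
    by (intro continuous_attains_inf compact_sphere)
  then obtain v where v: "norm v = 1"
    and vmin: "\<And>w. norm w = 1 \<Longrightarrow> v \<bullet> (M *v v) \<le> w \<bullet> (M *v w)"
    by auto
  define m where "m = v \<bullet> (M *v v)"
  have low: "m * (norm u)\<^sup>2 \<le> u \<bullet> (M *v u)" for u
  proof (cases "u = 0")
    case False
    define w where "w = (1 / norm u) *\<^sub>R u"
    have "norm w = 1" using False by (simp add: w_def)
    then have "m \<le> w \<bullet> (M *v w)" unfolding m_def by (rule vmin)
    also have "\<dots> = (u \<bullet> (M *v u)) / (norm u)\<^sup>2"
      by (simp add: w_def matrix_vector_mult_scaleR power2_eq_square)
    finally show ?thesis using False by (simp add: pos_le_divide_eq)
  qed simp
  let ?T = "\<lambda>u. M *v u - m *\<^sub>R u"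
  have lin: "linear ?T"
    by (intro linear_compose_sub matrix_vector_mul_linear linear_scale_self)
  have "?T v = 0"
  proof (rule psd_kernel[OF lin])
    show "u \<bullet> ?T w = ?T u \<bullet> w" for u w
      using sym[of u w] by (simp add: inner_diff_left inner_diff_right)
    show "0 \<le> u \<bullet> ?T u" for u
      using low[of u] by (simp add: inner_diff_right power2_norm_eq_inner)
    show "v \<bullet> ?T v = 0"
      using v by (simp add: inner_diff_right m_def norm_eq_sqrt_inner)
  qed
  then have eig: "v \<noteq> 0 \<and> M *v v = m *\<^sub>R v" using v by auto
  have "lambda_min M = m"
    unfolding lambda_min_def
  proof (rule Least_equality)
    show "\<exists>v. v \<noteq> 0 \<and> M *v v = m *\<^sub>R v" using eig by blast
    fix l assume "\<exists>u. u \<noteq> 0 \<and> M *v u = l *\<^sub>R u"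
    then obtain u where u: "u \<noteq> 0" "M *v u = l *\<^sub>R u" by blast
    then have "m * (norm u)\<^sup>2 \<le> l * (norm u)\<^sup>2"
      using low[of u] by (simp add: power2_norm_eq_inner)
    then show "m \<le> l" using u(1) by simp
  qed
  then show "\<exists>v. v \<noteq> 0 \<and> M *v v = lambda_min M *\<^sub>R v"
    and "lambda_min M * (norm u)\<^sup>2 \<le> u \<bullet> (M *v u)"
    using eig low by blast+
qed

text \<open>The quadratic forms of the two Gram matrices are the squared norms of
  \<open>A *v x\<close> and \<open>y v* A\<close>. The extremal vector in the third part yields the
  bounds on \<open>mu_A\<close>.\<close>

lemma lambda_min_gram:
  fixes A :: "real^'n^'m"
  shows "lambda_min (transpose A ** A) * (norm x)\<^sup>2 \<le> (norm (A *v x))\<^sup>2"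
    and "lambda_min (A ** transpose A) * (norm y)\<^sup>2 \<le> (norm (y v* A))\<^sup>2"
    and "\<exists>v. v \<noteq> 0 \<and> (norm (A *v v))\<^sup>2 = lambda_min (transpose A ** A) * (norm v)\<^sup>2"
proof -
  have s: "transpose (transpose A ** A) = transpose A ** A"
    "transpose (A ** transpose A) = A ** transpose A"
    by (simp_all add: matrix_transpose_mul)
  have eq: "v \<bullet> ((transpose A ** A) *v v) = (norm (A *v v))\<^sup>2" for v
    unfolding matrix_vector_mul_assoc[symmetric] transpose_matrix_vector
    by (metis dot_lmul_matrix inner_commute power2_norm_eq_inner)
  have eq2: "y \<bullet> ((A ** transpose A) *v y) = (norm (y v* A))\<^sup>2" for y
    unfolding matrix_vector_mul_assoc[symmetric] transpose_matrix_vector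
    by (metis dot_lmul_matrix power2_norm_eq_inner)
  show "lambda_min (transpose A ** A) * (norm x)\<^sup>2 \<le> (norm (A *v x))\<^sup>2"
    using lambda_min_eigenvector(2)[OF s(1), of x] eq by simp
  show "lambda_min (A ** transpose A) * (norm y)\<^sup>2 \<le> (norm (y v* A))\<^sup>2"
    using lambda_min_eigenvector(2)[OF s(2), of y] eq2 by simp
  obtain v where "v \<noteq> 0" "(transpose A ** A) *v v = lambda_min (transpose A ** A) *\<^sub>R v"
    using lambda_min_eigenvector(1)[OF s(1)] by blast
  then show "\<exists>v. v \<noteq> 0 \<and> (norm (A *v v))\<^sup>2 = lambda_min (transpose A ** A) * (norm v)\<^sup>2"
    using eq[of v] by (intro exI[of _ v]) (simp add: power2_norm_eq_inner)
qed

text \<open>The adjoint identity; from here on the product of the transpose of \<open>A\<close> with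
  \<open>y\<close> is written \<open>y v* A\<close>.\<close>

lemma inner_vector_matrix: "(x :: real^'n) \<bullet> (y v* A) = y \<bullet> (A *v x)"
  by (metis dot_lmul_matrix inner_commute)

lemma spectral_norm_nonneg: "0 \<le> spectral_norm A"
  unfolding spectral_norm_def by (rule onorm_pos_le[OF matrix_vector_mul_bounded_linear])

lemma norm_matrix_vector_le: "norm (A *v x) \<le> spectral_norm A * norm x"
  unfolding spectral_norm_def by (rule onorm[OF matrix_vector_mul_bounded_linear])

text \<open>The transpose inherits the spectral bound because the squared norm of
  \<open>y v* A\<close> is the inner product of \<open>y\<close> with \<open>A *v (y v* A)\<close>;
  one factor then cancels.\<close>

lemma norm_vector_matrix_le: "norm (y v* A) \<le> spectral_norm A * norm y"
proof (cases "y v* A = 0")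
  case False
  have "norm (y v* A) * norm (y v* A) = y \<bullet> (A *v (y v* A))"
    by (metis dot_lmul_matrix power2_eq_square power2_norm_eq_inner)
  also have "\<dots> \<le> norm y * (spectral_norm A * norm (y v* A))"
    by (intro order_trans[OF norm_cauchy_schwarz] mult_left_mono norm_matrix_vector_le) simp
  finally show ?thesis using False by (simp add: mult_ac)
qed (simp add: spectral_norm_nonneg)

lemma mu_A_nonneg: "0 \<le> mu_A A"
  and mu_A_le: "mu_A A \<le> (spectral_norm A)\<^sup>2"
proof -
  obtain v where v: "v \<noteq> 0" "(norm (A *v v))\<^sup>2 = mu_A A * (norm v)\<^sup>2"
    using lambda_min_gram(3)[of A] by (auto simp: mu_A_def)
  have "0 \<le> mu_A A * (norm v)\<^sup>2"
    using v(2) zero_le_power2[of "norm (A *v v)"] by simp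
  then show "0 \<le> mu_A A" using v(1) by (simp add: zero_le_mult_iff)
  have "mu_A A * (norm v)\<^sup>2 \<le> (spectral_norm A * norm v)\<^sup>2"
    unfolding v(2)[symmetric] by (intro power_mono norm_matrix_vector_le) simp
  then show "mu_A A \<le> (spectral_norm A)\<^sup>2"
    using v(1) by (simp add: power_mult_distrib)
qed

lemma mat_vector_mult: "mat c *v x = c *\<^sub>R (x :: real^'n)"
  by (simp add: vec_eq_iff matrix_vector_mult_def mat_def if_distrib[where f = "\<lambda>t. t * _"] cong: if_cong)

lemma uminus_matrix_vector: "(- A) *v x = - (A *v (x :: real^'n))"
  by (simp add: vec_eq_iff matrix_vector_mult_def sum_negf)

lemma linear_block_op: "linear (block_op P Q R S)"
  by (rule linearI) (auto simp: block_op_def matrix_vector_right_distrib matrix_vector_mult_scaleR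
      scaleR_add_right split: prod.split)

section \<open>The quadratic form of \<open>Phi\<close>\<close>

lemma Phi_apply: "Phi A \<tau> \<sigma> (x, y) = ((1 / \<tau>) *\<^sub>R x - y v* A, (1 / \<sigma>) *\<^sub>R y - A *v x)"
  by (simp add: Phi_def block_op_def mat_vector_mult uminus_matrix_vector)

lemma linear_Phi: "linear (Phi A \<tau> \<sigma>)"
  unfolding Phi_def by (rule linear_block_op)

lemma Phi_symmetric: "u \<bullet> Phi A \<tau> \<sigma> v = Phi A \<tau> \<sigma> u \<bullet> v"
proof -
  obtain x y x' y' where "u = (x, y)" "v = (x', y')" by fastforce
  then show ?thesis
    by (simp add: Phi_apply inner_diff_left inner_diff_right dot_lmul_matrix inner_vector_matrix
        inner_commute[of "A *v x" y'])
qed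

lemma Phi_quadratic:
  "(x, y) \<bullet> Phi A \<tau> \<sigma> (x, y) = (norm x)\<^sup>2 / \<tau> - 2 * (y \<bullet> (A *v x)) + (norm y)\<^sup>2 / \<sigma>"
  by (simp add: Phi_apply inner_diff_right power2_norm_eq_inner inner_vector_matrix)

text \<open>Completes the square in \<open>x\<close>. What remains is the form of the Schur
  complement in \<open>y\<close>, bounded below through the spectral norm.\<close>

lemma Phi_quadratic_ge:
  assumes "\<tau> > 0"
  shows "(1 / \<sigma> - \<tau> * (spectral_norm A)\<^sup>2) * (norm y)\<^sup>2 + (norm (x - \<tau> *\<^sub>R (y v* A)))\<^sup>2 / \<tau>
    \<le> (x, y) \<bullet> Phi A \<tau> \<sigma> (x, y)"
proof -
  have "(norm (x - \<tau> *\<^sub>R (y v* A)))\<^sup>2 = (norm x)\<^sup>2 - 2 * \<tau> * (y \<bullet> (A *v x)) + \<tau>\<^sup>2 * (norm (y v* A))\<^sup>2"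
    unfolding power2_norm_eq_inner dot_lmul_matrix[symmetric]
    by (simp add: inner_diff_left inner_diff_right inner_commute power2_eq_square)
  then have "(norm (x - \<tau> *\<^sub>R (y v* A)))\<^sup>2 / \<tau>
      = (norm x)\<^sup>2 / \<tau> - 2 * (y \<bullet> (A *v x)) + \<tau> * (norm (y v* A))\<^sup>2"
    using assms by (simp add: field_simps power2_eq_square)
  moreover have "\<tau> * (norm (y v* A))\<^sup>2 \<le> \<tau> * (spectral_norm A * norm y)\<^sup>2"
    using assms by (intro mult_left_mono power_mono norm_vector_matrix_le) auto
  ultimately show ?thesis
    unfolding Phi_quadratic by (simp add: power_mult_distrib algebra_simps)
qed

text \<open>Twice the product of the norms of \<open>x\<close> and \<open>y\<close> is at most the
  sum of their squares, so the off-diagonal blocks add at most the spectral norm to the larger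
  diagonal coefficient.\<close>

lemma Phi_quadratic_le:
  assumes "\<tau> > 0" "\<sigma> > 0"
  shows "w \<bullet> Phi A \<tau> \<sigma> w \<le> zeta A \<tau> \<sigma> * (norm w)\<^sup>2"
proof -
  obtain x y where w: "w = (x, y)" by fastforce
  define X where "X = norm x"
  define Y where "Y = norm y"
  have "- (y \<bullet> (A *v x)) \<le> norm y * norm (A *v x)"
    using Cauchy_Schwarz_ineq2[of y "A *v x"] by linarith
  also have "\<dots> \<le> norm y * (spectral_norm A * norm x)"
    by (intro mult_left_mono norm_matrix_vector_le) simp
  finally have "- (y \<bullet> (A *v x)) \<le> spectral_norm A * (X * Y)"
    by (simp only: X_def Y_def mult_ac)
  moreover have "spectral_norm A * (2 * X * Y) \<le> spectral_norm A * (X\<^sup>2 + Y\<^sup>2)"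
    by (intro mult_left_mono sum_squares_bound spectral_norm_nonneg)
  ultimately have "- 2 * (y \<bullet> (A *v x)) \<le> spectral_norm A * (X\<^sup>2 + Y\<^sup>2)"
    by linarith
  moreover define m where "m = max (1 / \<tau>) (1 / \<sigma>)"
  have "X\<^sup>2 / \<tau> \<le> m * X\<^sup>2" "Y\<^sup>2 / \<sigma> \<le> m * Y\<^sup>2"
    using mult_right_mono[of "1 / \<tau>" m "X\<^sup>2"] mult_right_mono[of "1 / \<sigma>" m "Y\<^sup>2"]
    by (simp_all add: m_def)
  ultimately have "X\<^sup>2 / \<tau> - 2 * (y \<bullet> (A *v x)) + Y\<^sup>2 / \<sigma> \<le> (m + spectral_norm A) * (X\<^sup>2 + Y\<^sup>2)"
    unfolding distrib_left distrib_right by linarith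
  moreover have "(norm w)\<^sup>2 = X\<^sup>2 + Y\<^sup>2"
    by (simp add: w X_def Y_def norm_Pair)
  ultimately show ?thesis
    unfolding w Phi_quadratic zeta_def X_def Y_def m_def by simp
qed

lemma zeta_pos: "\<tau> > 0 \<Longrightarrow> 0 < zeta A \<tau> \<sigma>"
  using spectral_norm_nonneg[of A] by (auto simp: zeta_def less_max_iff_disj intro!: add_pos_nonneg)

lemma pos_def_Phi:
  fixes A :: "real^'n^'m"
  assumes "\<tau> > 0" "1 / \<sigma> - \<tau> * (spectral_norm A)\<^sup>2 > 0"
  shows "pos_def_op (Phi A \<tau> \<sigma>)"
  unfolding pos_def_op_def
proof (intro conjI allI impI)
  show "linear (Phi A \<tau> \<sigma>)" by (rule linear_Phi)
  show "u \<bullet> Phi A \<tau> \<sigma> v = Phi A \<tau> \<sigma> u \<bullet> v" for u v by (rule Phi_symmetric)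
  fix u :: "(real^'n) \<times> (real^'m)" assume u: "u \<noteq> 0"
  obtain x y where xy: "u = (x, y)" by fastforce
  have "0 < (1 / \<sigma> - \<tau> * (spectral_norm A)\<^sup>2) * (norm y)\<^sup>2 + (norm (x - \<tau> *\<^sub>R (y v* A)))\<^sup>2 / \<tau>"
  proof (cases "y = 0")
    case True
    then have "x \<noteq> 0" using u xy by (auto simp: zero_prod_def)
    then show ?thesis using True assms by simp
  next
    case False
    then show ?thesis using assms by (intro add_pos_nonneg mult_pos_pos) auto
  qed
  also have "\<dots> \<le> u \<bullet> Phi A \<tau> \<sigma> u"
    unfolding xy by (rule Phi_quadratic_ge[OF assms(1)])
  finally show "0 < u \<bullet> Phi A \<tau> \<sigma> u" .
qed

text \<open>The Schur complement is bounded below by \<open>\<xi>\<close>, hence injective, hence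
  surjective in finite dimension. The same lower bound gives norm \<open>k\<close> at most norm
  \<open>h\<close> over \<open>\<xi>\<close>. The solution \<open>k\<close> is the second block of
  the vector \<open>e\<close> in \<open>Phi_descent\<close>.\<close>

lemma Schur_complement_solvable:
  fixes A :: "real^'n^'m"
  assumes "\<tau> > 0" and \<xi>: "1 / \<sigma> - \<tau> * (spectral_norm A)\<^sup>2 > 0" (is "?\<xi> > 0")
  obtains k where "(1 / \<sigma>) *\<^sub>R k - \<tau> *\<^sub>R (A *v (k v* A)) = h" "h \<bullet> k \<le> (norm h)\<^sup>2 / ?\<xi>"
proof -
  let ?S = "\<lambda>k. (1 / \<sigma>) *\<^sub>R k - \<tau> *\<^sub>R (A *v (k v* A))"
  have lin: "linear ?S"
    by (rule linearI) (simp_all add: transpose_matrix_vector[symmetric] matrix_vector_right_distrib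
        matrix_vector_mult_scaleR algebra_simps del: transpose_matrix_vector)
  have low: "?\<xi> * (norm k)\<^sup>2 \<le> k \<bullet> ?S k" for k
  proof -
    have "\<tau> * (norm (k v* A))\<^sup>2 \<le> \<tau> * (spectral_norm A * norm k)\<^sup>2"
      using assms by (intro mult_left_mono power_mono norm_vector_matrix_le) auto
    moreover have "k \<bullet> (A *v (k v* A)) = (norm (k v* A))\<^sup>2"
      by (metis dot_lmul_matrix power2_norm_eq_inner)
    then have "k \<bullet> ?S k = (norm k)\<^sup>2 / \<sigma> - \<tau> * (norm (k v* A))\<^sup>2"
      by (simp add: inner_diff_right power2_norm_eq_inner)
    ultimately show ?thesis
      by (simp add: power_mult_distrib algebra_simps)
  qed
  have "inj ?S"
    unfolding linear_injective_0[OF lin]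
  proof (intro allI impI)
    fix k assume "?S k = 0"
    then have "?\<xi> * (norm k)\<^sup>2 \<le> 0" using low[of k] by simp
    then show "k = 0" using \<xi> by (simp add: mult_le_0_iff)
  qed
  then have "surj ?S" using linear_injective_imp_surjective[OF lin] by simp
  then obtain k where "h = ?S k" by (rule surjE)
  then have k: "?S k = h" by (rule sym)
  have "?\<xi> * (norm k)\<^sup>2 \<le> h \<bullet> k" using low[of k] k by (simp add: inner_commute)
  also have hk: "h \<bullet> k \<le> norm h * norm k" by (rule norm_cauchy_schwarz)
  finally have "norm k * (?\<xi> * norm k) \<le> norm k * norm h"
    by (simp add: power2_eq_square mult_ac)
  then have "norm k \<le> norm h / ?\<xi>"
    using \<xi> by (cases "k = 0") (simp_all add: pos_le_divide_eq mult.commute)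
  then have "norm h * norm k \<le> norm h * (norm h / ?\<xi>)" by (rule mult_left_mono) simp
  with hk have "h \<bullet> k \<le> (norm h)\<^sup>2 / ?\<xi>" by (simp add: power2_eq_square)
  with k show thesis by (rule that)
qed

text \<open>Purely algebraic: \<open>p\<close> and \<open>h\<close> are arbitrary vectors tied to
  the differences only by the two update equations. The form is expanded for the old difference
  around the new one and for the step \<open>v\<close> around \<open>e\<close>; then
  \<open>h \<bullet> b'\<close> and \<open>h \<bullet> (b - b')\<close> add up to
  \<open>h \<bullet> b\<close> at the old point, where cocoercivity applies.\<close>

lemma Phi_descent:
  fixes A :: "real^'n^'m" and \<tau> \<sigma> :: real
  defines "Q \<equiv> \<lambda>w. w \<bullet> Phi A \<tau> \<sigma> w"
  assumes \<tau>: "\<tau> > 0" and \<sigma>: "\<sigma> > 0" and \<xi>: "1 / \<sigma> - \<tau> * (spectral_norm A)\<^sup>2 > 0" (is "?\<xi> > 0")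
    and a: "a = a' + \<tau> *\<^sub>R (p + b v* A)"
    and b': "b' = b - \<sigma> *\<^sub>R (h - A *v (2 *\<^sub>R a' - a))"
  shows "Q (a', b') + ((norm (p + b' v* A))\<^sup>2 + (norm (A *v a'))\<^sup>2) / zeta A \<tau> \<sigma> + 2 * (p \<bullet> a') + 2 * (h \<bullet> b)
    \<le> Q (a, b) + (norm h)\<^sup>2 / ?\<xi>"
proof -
  let ?T = "Phi A \<tau> \<sigma>"
  let ?\<zeta> = "zeta A \<tau> \<sigma>"
  note lin = linear_Phi[of A \<tau> \<sigma>]
  have Q_add: "Q (u + v) = Q u + Q v + 2 * (u \<bullet> ?T v)" for u v
  proof -
    have "v \<bullet> ?T u = u \<bullet> ?T v"
      using Phi_symmetric[of v A \<tau> \<sigma> u] by (simp only: inner_commute)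
    then show ?thesis
      unfolding Q_def by (simp add: linear_add[OF lin] inner_add_left inner_add_right)
  qed
  have \<zeta>: "?\<zeta> > 0" by (rule zeta_pos[OF \<tau>])
  have Q0: "0 \<le> Q u" for u
  proof (cases "u = 0")
    case False
    then have "0 < Q u"
      using pos_def_Phi[OF \<tau> \<xi>] unfolding pos_def_op_def Q_def by blast
    then show ?thesis by simp
  qed (simp add: Q_def)
  define v where "v = (a - a', b - b')"
  \<comment> \<open>The extrapolation \<open>2 *\<^sub>R a' - a\<close> in the second update is what
    makes the old \<open>a\<close> cancel in the second block.\<close>
  have Tv: "?T v = (p + b' v* A, h - A *v a')"
  proof -
    have "(1 / \<tau>) *\<^sub>R (a - a') = p + b v* A"
      using \<tau> by (simp add: a)
    moreover have "(1 / \<sigma>) *\<^sub>R (b - b') = h - (2 *\<^sub>R (A *v a') - A *v a)"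
      using \<sigma> by (simp add: b' matrix_vector_mult_diff_distrib matrix_vector_mult_scaleR)
    ultimately show ?thesis
      unfolding v_def Phi_apply
      by (simp add: algebra_simps scaleR_2)
  qed
  obtain k where k: "(1 / \<sigma>) *\<^sub>R k - \<tau> *\<^sub>R (A *v (k v* A)) = h" "h \<bullet> k \<le> (norm h)\<^sup>2 / ?\<xi>"
    using Schur_complement_solvable[OF \<tau> \<xi>] by blast
  \<comment> \<open>Block elimination: the zero first block of \<open>\<Phi> e\<close> forces the
    \<open>x\<close> part, and the second block is then the Schur equation for
    \<open>k\<close>.\<close>
  define e where "e = (\<tau> *\<^sub>R (k v* A), k)"
  have Te: "?T e = (0, h)"
    using \<tau> k(1) by (simp add: e_def Phi_apply matrix_vector_mult_scaleR)
  have Qe: "Q e = h \<bullet> k"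
    unfolding Q_def Te by (simp add: e_def inner_commute)
  have "Q v = Q (v - e) + Q e + 2 * ((v - e) \<bullet> (0, h))"
    using Q_add[of "v - e" e] by (simp add: Te)
  also have "(v - e) \<bullet> (0, h) = h \<bullet> (b - b') - h \<bullet> k"
    by (simp add: v_def e_def inner_diff_right inner_diff_left inner_commute)
  finally have Qv: "Q v = Q (v - e) + 2 * (h \<bullet> (b - b')) - h \<bullet> k"
    using Qe by simp
  have "?T (v - e) = (p + b' v* A, - (A *v a'))"
    by (simp add: linear_diff[OF lin] Tv Te)
  then have "(norm (p + b' v* A))\<^sup>2 + (norm (A *v a'))\<^sup>2 = (norm (?T (v - e)))\<^sup>2"
    by (simp add: norm_Pair)
  then have "((norm (p + b' v* A))\<^sup>2 + (norm (A *v a'))\<^sup>2) / ?\<zeta> \<le> Q (v - e)"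
    using psd_operator_bound[OF lin Phi_symmetric Q0[unfolded Q_def] Phi_quadratic_le[OF \<tau> \<sigma>] \<zeta>, of "v - e"]
    by (simp add: Q_def)
  moreover have "Q (a, b) = Q (a', b') + Q v + 2 * (p \<bullet> a' + h \<bullet> b')"
  proof -
    \<comment> \<open>The two coupling terms are skew and cancel, so no bilinear term in
      \<open>A\<close> is left.\<close>
    have "(a', b') \<bullet> ?T v = p \<bullet> a' + h \<bullet> b'"
      unfolding Tv by (simp add: inner_add_right inner_diff_right inner_vector_matrix inner_commute[of a' p]
          inner_commute[of b' h])
    moreover have "(a, b) = (a', b') + v" by (simp add: v_def)
    ultimately show ?thesis using Q_add[of "(a', b')" v] by simp
  qed
  ultimately show ?thesis
    using Qv k(2) by (simp add: inner_diff_right)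
qed

section \<open>One step of the method\<close>

lemma smooth_fun_gradient:
  assumes "smooth_fun L f"
  shows "GDERIV (\<lambda>z. real_of_ereal (f z)) x :> gradient (\<lambda>z. real_of_ereal (f z)) x"
    and "norm (gradient (\<lambda>z. real_of_ereal (f z)) x - gradient (\<lambda>z. real_of_ereal (f z)) y)
      \<le> L * norm (x - y)"
    and "0 \<le> L"
proof -
  show "GDERIV (\<lambda>z. real_of_ereal (f z)) x :> gradient (\<lambda>z. real_of_ereal (f z)) x"
    using assms by (intro differentiable_imp_GDERIV_gradient) (simp add: smooth_fun_def)
  have lip: "L-lipschitz_on UNIV (gradient (\<lambda>z. real_of_ereal (f z)))"
    using assms by (simp add: smooth_fun_def)
  show "norm (gradient (\<lambda>z. real_of_ereal (f z)) x - gradient (\<lambda>z. real_of_ereal (f z)) y)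
      \<le> L * norm (x - y)"
    by (rule lipschitz_on_normD[OF lip]) auto
  show "0 \<le> L" by (rule lipschitz_on_nonneg[OF lip])
qed

text \<open>The function minus the affine minorant with slope \<open>s\<close> has a minimum at
  \<open>x\<close>, so its derivative there is zero.\<close>

lemma subgradient_eq_gradient:
  fixes F :: "'a::real_inner \<Rightarrow> real"
  assumes D: "GDERIV F x :> D" and sub: "\<And>z. F x + s \<bullet> (z - x) \<le> F z"
  shows "D = s"
proof -
  have "((\<lambda>z. F z - s \<bullet> (z - x)) has_derivative (\<lambda>h. h \<bullet> D - s \<bullet> h)) (at x)"
    using D unfolding gderiv_def by (auto intro!: derivative_eq_intros)
  moreover have "\<forall>z\<in>UNIV. F x - s \<bullet> (x - x) \<le> F z - s \<bullet> (z - x)"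
    using sub by (simp add: algebra_simps)
  ultimately have "(\<lambda>h. h \<bullet> D - s \<bullet> h) = (\<lambda>h. 0)"
    by (intro differential_zero_maxmin[of x UNIV]) auto
  then have "h \<bullet> (D - s) = 0" for h
    using fun_cong[of "\<lambda>h. h \<bullet> D - s \<bullet> h" "\<lambda>h. 0" h] by (simp add: inner_diff_right inner_commute[of s])
  from this[of "D - s"] show ?thesis by simp
qed

text \<open>Both models are expanded at 0 and compared at a unit vector, where the affine parts
  cancel.\<close>

lemma strong_convexity_modulus_le_smoothness:
  fixes g :: "'a::euclidean_space \<Rightarrow> real"
  assumes sm: "smooth_fun L (\<lambda>y. ereal (g y))" and sc: "strongly_convex_fun \<mu> (\<lambda>y. ereal (g y))"
  shows "\<mu> \<le> L"
proof -
  obtain d :: 'a where d: "norm d = 1"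
    by (metis nonempty_Basis norm_Basis ex_in_conv)
  have G: "GDERIV g x :> gradient g x" for x
    using smooth_fun_gradient(1)[OF sm] by simp
  have "L-lipschitz_on UNIV (gradient g)"
    using sm by (simp add: smooth_fun_def)
  from smooth_upper_bound[OF G this, of d 0] strongly_convex_lower_bound[OF sc G, of 0 d] d
  show ?thesis by simp
qed

lemma gradient_strongly_monotone_cocoercive:
  fixes g :: "'a::euclidean_space \<Rightarrow> real"
  assumes sm: "smooth_fun L (\<lambda>y. ereal (g y))" and sc: "strongly_convex_fun \<mu> (\<lambda>y. ereal (g y))"
    and \<mu>: "0 \<le> \<mu>" and L: "L > 0"
  shows "L * \<mu> / (L + \<mu>) * (norm (x - y))\<^sup>2 + (norm (gradient g x - gradient g y))\<^sup>2 / (L + \<mu>)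
      \<le> (gradient g x - gradient g y) \<bullet> (x - y)"
    and "\<mu> * norm (x - y) \<le> norm (gradient g x - gradient g y)"
proof -
  have G: "GDERIV g x :> gradient g x" for x
    using smooth_fun_gradient(1)[OF sm] by simp
  have lip: "L-lipschitz_on UNIV (gradient g)"
    using sm by (simp add: smooth_fun_def)
  note low = strongly_convex_lower_bound[OF sc G]
  show "L * \<mu> / (L + \<mu>) * (norm (x - y))\<^sup>2 + (norm (gradient g x - gradient g y))\<^sup>2 / (L + \<mu>)
      \<le> (gradient g x - gradient g y) \<bullet> (x - y)"
    using smooth_upper_bound[OF G lip] low lipschitz_on_normD[OF lip] \<mu> L
      strong_convexity_modulus_le_smoothness[OF sm sc]
    by (intro strongly_convex_smooth_cocoercive) auto
  have "\<mu> * (norm (x - y))\<^sup>2 \<le> (gradient g x - gradient g y) \<bullet> (x - y)"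
    using low[of x y] low[of y x] by (simp add: inner_diff_left inner_diff_right norm_minus_commute)
  also have "\<dots> \<le> norm (gradient g x - gradient g y) * norm (x - y)"
    by (rule norm_cauchy_schwarz)
  finally show "\<mu> * norm (x - y) \<le> norm (gradient g x - gradient g y)"
    by (cases "x = y") (simp_all add: power2_eq_square)
qed

text \<open>Pays for the cost \<open>(norm h)\<^sup>2 / \<xi>\<close> of the explicit gradient when
  \<open>g\<close> is merely convex. For \<open>L = 0\<close> the gradient is constant and both
  sides vanish; otherwise cocoercivity with constant \<open>L\<close> suffices.\<close>

lemma gradient_cocoercive:
  fixes g :: "'a::euclidean_space \<Rightarrow> real"
  assumes sm: "smooth_fun L (\<lambda>y. ereal (g y))" and cv: "convex_fun (\<lambda>y. ereal (g y))"
    and \<xi>: "L / 2 \<le> \<xi>" "0 < \<xi>"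
  shows "(norm (gradient g x - gradient g y))\<^sup>2 / \<xi> \<le> 2 * ((gradient g x - gradient g y) \<bullet> (x - y))"
proof (cases "L = 0")
  case True
  then show ?thesis
    using smooth_fun_gradient(2)[OF sm, of x y] by simp
next
  case False
  then have L: "L > 0" using smooth_fun_gradient(3)[OF sm] by simp
  have "(norm (gradient g x - gradient g y))\<^sup>2 / \<xi> \<le> (norm (gradient g x - gradient g y))\<^sup>2 / (L / 2)"
    using \<xi> L by (intro divide_left_mono mult_pos_pos) auto
  also have "\<dots> = 2 * ((norm (gradient g x - gradient g y))\<^sup>2 / L)" by simp
  also have "\<dots> \<le> 2 * ((gradient g x - gradient g y) \<bullet> (x - y))"
    using gradient_strongly_monotone_cocoercive(1)[OF sm, of 0 x y] cv L
    by (simp add: convex_fun_eq_strongly_convex)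
  finally show ?thesis .
qed

section \<open>Fixed points, saddle points and the descent of two runs\<close>

lemma sipd_step_eq:
  "sipd_step f g A \<tau> \<sigma> (x, y) =
    (let x' = prox (\<lambda>z. ereal \<tau> * f z) (x - \<tau> *\<^sub>R (y v* A))
     in (x', y - \<sigma> *\<^sub>R (gradient g y - A *v (2 *\<^sub>R x' - x))))"
  by (simp add: sipd_step_def Let_def)

text \<open>The two saddle inequalities decouple: minus \<open>y v* A\<close> is a subgradient of
  \<open>f\<close> at \<open>x\<close>, and \<open>A *v x\<close> is a subgradient of
  \<open>g\<close> at \<open>y\<close>. On the domain of \<open>f\<close> the Lagrangian is real, so
  its terms can be cancelled.\<close>

lemma saddle_solution_iff:
  fixes A :: "real^'n^'m"
  assumes f: "proper_fun f"
  defines "F \<equiv> \<lambda>x. real_of_ereal (f x)"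
  shows "saddle_solution f (\<lambda>y. ereal (g y)) A x y \<longleftrightarrow> x \<in> effective_domain f \<and>
    (\<forall>z\<in>effective_domain f. F x - (y v* A) \<bullet> (z - x) \<le> F z) \<and> (\<forall>w. g y + (A *v x) \<bullet> (w - y) \<le> g w)"
proof -
  have L: "lagrangian f (\<lambda>y. ereal (g y)) A z w = ereal (F z + w \<bullet> (A *v z) - g w)"
    if "z \<in> effective_domain f" for z w
  proof -
    have "f z = ereal (F z)"
      using real_of_ereal_of_domain[OF f that] by (simp add: F_def)
    then show ?thesis by (simp add: lagrangian_def)
  qed
  have D: "effective_domain (\<lambda>y. ereal (g y)) = UNIV"
    by (auto simp: effective_domain_def)
  have "saddle_solution f (\<lambda>y. ereal (g y)) A x y \<longleftrightarrow> x \<in> effective_domain f \<and>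
    (\<forall>z\<in>effective_domain f. \<forall>w. F x + w \<bullet> (A *v x) - g w \<le> F x + y \<bullet> (A *v x) - g y \<and>
       F x + y \<bullet> (A *v x) - g y \<le> F z + y \<bullet> (A *v z) - g y)"
    unfolding saddle_solution_def D by (auto simp: L)
  also have "\<dots> \<longleftrightarrow> x \<in> effective_domain f \<and>
    (\<forall>z\<in>effective_domain f. F x - (y v* A) \<bullet> (z - x) \<le> F z) \<and> (\<forall>w. g y + (A *v x) \<bullet> (w - y) \<le> g w)"
  proof -
    have 1: "F x + w \<bullet> (A *v x) - g w \<le> F x + y \<bullet> (A *v x) - g y \<longleftrightarrow> g y + (A *v x) \<bullet> (w - y) \<le> g w" for w
      by (auto simp: inner_diff_right inner_commute[of "A *v x"])
    have 2: "F x + y \<bullet> (A *v x) - g y \<le> F z + y \<bullet> (A *v z) - g y \<longleftrightarrow> F x - (y v* A) \<bullet> (z - x) \<le> F z" for z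
      by (auto simp: inner_diff_right dot_lmul_matrix)
    show ?thesis unfolding 1 2 by blast
  qed
  finally show ?thesis .
qed

text \<open>At a fixed point the extrapolated point is \<open>x\<close> itself, so the updates
  become the prox characterization of the first optimality condition and the gradient equation for
  the second.\<close>

lemma sipd_fixed_point_iff_saddle:
  fixes A :: "real^'n^'m"
  assumes f: "proper_fun f" "convex_fun f" "closed_fun f"
    and cv: "convex_fun (\<lambda>y. ereal (g y))" and sm: "smooth_fun L (\<lambda>y. ereal (g y))"
    and \<tau>: "\<tau> > 0" and \<sigma>: "\<sigma> > 0"
  shows "sipd_step f g A \<tau> \<sigma> (x, y) = (x, y) \<longleftrightarrow> saddle_solution f (\<lambda>y. ereal (g y)) A x y"
proof -
  let ?F = "\<lambda>x. real_of_ereal (f x)"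
  have G: "GDERIV g y :> gradient g y"
    using smooth_fun_gradient(1)[OF sm] by simp
  have "gradient g y = A *v x \<longleftrightarrow> (\<forall>w. g y + (A *v x) \<bullet> (w - y) \<le> g w)"
    using subgradient_eq_gradient[OF G] strongly_convex_lower_bound[OF _ G, of 0] cv
    by (auto simp: convex_fun_eq_strongly_convex)
  moreover have "(1 / \<tau>) * ((x - \<tau> *\<^sub>R (y v* A) - x) \<bullet> d) = - ((y v* A) \<bullet> d)" for d
    using \<tau> by simp
  then have "prox (\<lambda>z. ereal \<tau> * f z) (x - \<tau> *\<^sub>R (y v* A)) = x \<longleftrightarrow>
      x \<in> effective_domain f \<and> (\<forall>z\<in>effective_domain f. ?F x - (y v* A) \<bullet> (z - x) \<le> ?F z)"
    unfolding prox_characterization[OF f \<tau>] by simp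
  moreover have "sipd_step f g A \<tau> \<sigma> (x, y) = (x, y) \<longleftrightarrow>
      prox (\<lambda>z. ereal \<tau> * f z) (x - \<tau> *\<^sub>R (y v* A)) = x \<and> gradient g y = A *v x"
    using \<sigma> by (auto simp: sipd_step_eq Let_def scaleR_2)
  ultimately show ?thesis
    unfolding saddle_solution_iff[OF f(1)] by blast
qed

text \<open>The prox residual divided by \<open>\<tau>\<close> names the subgradient of
  \<open>f\<close> that the step selects at its new point.\<close>

lemma sipd_step_subgradient:
  fixes A :: "real^'n^'m"
  assumes f: "proper_fun f" "convex_fun f" "closed_fun f" and sc: "strongly_convex_fun \<mu> f"
    and \<tau>: "\<tau> > 0" and step: "sipd_step f g A \<tau> \<sigma> (x, y) = (x', y')"
  defines "F \<equiv> \<lambda>x. real_of_ereal (f x)"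
  shows "x' \<in> effective_domain f"
    and "z \<in> effective_domain f \<Longrightarrow>
      F x' + ((1 / \<tau>) *\<^sub>R (x - x') - y v* A) \<bullet> (z - x') + \<mu> / 2 * (norm (z - x'))\<^sup>2 \<le> F z"
proof -
  have x': "prox (\<lambda>z. ereal \<tau> * f z) (x - \<tau> *\<^sub>R (y v* A)) = x'"
    using step by (simp add: sipd_step_eq Let_def)
  show "x' \<in> effective_domain f"
    using prox_minimizes(1)[OF f \<tau>] x' by blast
  assume z: "z \<in> effective_domain f"
  have "(1 / \<tau>) *\<^sub>R (x - x') - y v* A = (1 / \<tau>) *\<^sub>R (x - \<tau> *\<^sub>R (y v* A) - x')"
    using \<tau> by (simp add: algebra_simps)
  then show "F x' + ((1 / \<tau>) *\<^sub>R (x - x') - y v* A) \<bullet> (z - x') + \<mu> / 2 * (norm (z - x'))\<^sup>2 \<le> F z"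
    using prox_subgradient[OF f \<tau> sc z, of "x - \<tau> *\<^sub>R (y v* A)", unfolded x'] by (simp add: F_def)
qed

text \<open>The subgradient inequalities of the two runs, each tested at the other's new point, add
  up to strong monotonicity of \<open>p\<close> against the new \<open>x\<close> difference. The
  rest is \<open>Phi_descent\<close> for the differences of the updates.\<close>

lemma sipd_step_descent:
  fixes A :: "real^'n^'m"
  assumes f: "proper_fun f" "convex_fun f" "closed_fun f" and sc: "strongly_convex_fun \<mu> f"
    and \<tau>: "\<tau> > 0" and \<sigma>: "\<sigma> > 0" and \<xi>: "1 / \<sigma> - \<tau> * (spectral_norm A)\<^sup>2 > 0" (is "?\<xi> > 0")
    and step1: "sipd_step f g A \<tau> \<sigma> (x1, y1) = (x1', y1')"
    and step2: "sipd_step f g A \<tau> \<sigma> (x2, y2) = (x2', y2')"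
  defines "p \<equiv> ((1 / \<tau>) *\<^sub>R (x1 - x1') - y1 v* A) - ((1 / \<tau>) *\<^sub>R (x2 - x2') - y2 v* A)"
    and "h \<equiv> gradient g y1 - gradient g y2"
  shows "(x1' - x2', y1' - y2') \<bullet> Phi A \<tau> \<sigma> (x1' - x2', y1' - y2')
      + ((norm (p + (y1' - y2') v* A))\<^sup>2 + (norm (A *v (x1' - x2')))\<^sup>2) / zeta A \<tau> \<sigma>
      + 2 * \<mu> * (norm (x1' - x2'))\<^sup>2 + 2 * (h \<bullet> (y1 - y2))
    \<le> (x1 - x2, y1 - y2) \<bullet> Phi A \<tau> \<sigma> (x1 - x2, y1 - y2) + (norm h)\<^sup>2 / ?\<xi>"
proof -
  let ?F = "\<lambda>x. real_of_ereal (f x)"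
  let ?s1 = "(1 / \<tau>) *\<^sub>R (x1 - x1') - y1 v* A" and ?s2 = "(1 / \<tau>) *\<^sub>R (x2 - x2') - y2 v* A"
  note sub1 = sipd_step_subgradient[OF f sc \<tau> step1]
  note sub2 = sipd_step_subgradient[OF f sc \<tau> step2]
  have "?F x1' + ?s1 \<bullet> (x2' - x1') + \<mu> / 2 * (norm (x2' - x1'))\<^sup>2 \<le> ?F x2'"
    by (rule sub1(2)[OF sub2(1)])
  moreover have "?F x2' + ?s2 \<bullet> (x1' - x2') + \<mu> / 2 * (norm (x1' - x2'))\<^sup>2 \<le> ?F x1'"
    by (rule sub2(2)[OF sub1(1)])
  moreover have "p \<bullet> (x1' - x2') = - (?s1 \<bullet> (x2' - x1')) - ?s2 \<bullet> (x1' - x2')"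
    unfolding p_def by (simp only: inner_diff_left[of ?s1 ?s2] inner_minus_right[symmetric] minus_diff_eq)
  ultimately have mono: "\<mu> * (norm (x1' - x2'))\<^sup>2 \<le> p \<bullet> (x1' - x2')"
    by (simp add: norm_minus_commute[of x2' x1'])
  have a: "x1 - x2 = (x1' - x2') + \<tau> *\<^sub>R (p + (y1 - y2) v* A)"
    using \<tau> by (simp add: p_def vector_matrix_mult_diff_distrib algebra_simps)
  have y': "y1' = y1 - \<sigma> *\<^sub>R (gradient g y1 - A *v (2 *\<^sub>R x1' - x1))"
    "y2' = y2 - \<sigma> *\<^sub>R (gradient g y2 - A *v (2 *\<^sub>R x2' - x2))"
    using step1 step2 by (auto simp: sipd_step_eq Let_def)
  have b: "y1' - y2' = (y1 - y2) - \<sigma> *\<^sub>R (h - A *v (2 *\<^sub>R (x1' - x2') - (x1 - x2)))"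
    unfolding y' by (simp add: h_def matrix_vector_mult_diff_distrib matrix_vector_mult_scaleR algebra_simps)
  from Phi_descent[OF \<tau> \<sigma> \<xi> a b] mono show ?thesis
    by linarith
qed

lemma contractive_in_sqrt:
  assumes "pos_def_op \<Phi>" "0 \<le> c" "c < 1"
    and "\<And>w w'. (T w - T w') \<bullet> \<Phi> (T w - T w') \<le> c * ((w - w') \<bullet> \<Phi> (w - w'))"
  shows "contractive_in \<Phi> (sqrt c) T"
  unfolding contractive_in_def weighted_norm_def
  using assms by (auto simp: real_sqrt_mult[symmetric])

lemma Psi_apply: "Psi A \<mu>f \<tau> \<sigma> (x, y) = Phi A \<tau> \<sigma> (x, y) + (gamma_x A \<mu>f \<tau> \<sigma> *\<^sub>R x, 0)"
  by (simp add: Psi_def block_op_def mat_vector_mult)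

lemma pos_def_Psi:
  fixes A :: "real^'n^'m"
  assumes "\<tau> > 0" "1 / \<sigma> - \<tau> * (spectral_norm A)\<^sup>2 > 0" and \<gamma>: "0 \<le> gamma_x A \<mu>f \<tau> \<sigma>"
  shows "pos_def_op (Psi A \<mu>f \<tau> \<sigma>)"
  unfolding pos_def_op_def
proof (intro conjI allI impI)
  note Phi = pos_def_Phi[OF assms(1,2)]
  show "linear (Psi A \<mu>f \<tau> \<sigma>)"
    unfolding Psi_def by (intro linear_compose_add linear_Phi linear_block_op)
  show "u \<bullet> Psi A \<mu>f \<tau> \<sigma> v = Psi A \<mu>f \<tau> \<sigma> u \<bullet> v" for u v
    using Phi_symmetric[of u A \<tau> \<sigma> v]
    by (cases u; cases v) (simp add: Psi_apply inner_add_left inner_add_right)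
  fix u :: "(real^'n) \<times> (real^'m)" assume u: "u \<noteq> 0"
  obtain x y where xy: "u = (x, y)" by fastforce
  have "0 < u \<bullet> Phi A \<tau> \<sigma> u" using Phi u unfolding pos_def_op_def by blast
  moreover have "0 \<le> gamma_x A \<mu>f \<tau> \<sigma> * (x \<bullet> x)" using \<gamma> by simp
  ultimately show "0 < u \<bullet> Psi A \<mu>f \<tau> \<sigma> u"
    by (simp add: xy Psi_apply inner_add_right)
qed

text \<open>\<open>B\<close>, \<open>H\<close> and \<open>c\<close> stand for the squared norms of
  \<open>b\<close> and \<open>h\<close> and for \<open>h \<bullet> b\<close>. After cocoercivity
  \<open>H\<close> carries the coefficient \<open>2 / (L + \<mu>) - 1 / \<xi>\<close>; its sign
  decides whether the lower or the upper bound on \<open>H\<close> is inserted, which is the case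
  split of \<open>gamma_y\<close>.\<close>

lemma gamma_y_bound:
  fixes A :: "real^'n^'m" and B H c \<tau> \<sigma> :: real
  defines "\<xi> \<equiv> 1 / \<sigma> - \<tau> * (spectral_norm A)\<^sup>2"
  assumes \<tau>: "\<tau> > 0" and \<mu>: "\<mu> > 0" "\<mu> \<le> L" and \<xi>: "L / 2 < \<xi>"
    and B: "0 \<le> B" and H: "\<mu>\<^sup>2 * B \<le> H" "H \<le> L\<^sup>2 * B" and c: "L * \<mu> / (L + \<mu>) * B + H / (L + \<mu>) \<le> c"
  shows "gamma_y A \<mu> L \<tau> \<sigma> * B \<le> 2 * c - H / \<xi>" and "0 < gamma_y A \<mu> L \<tau> \<sigma>"
proof -
  define \<xi>2 where "\<xi>2 = 1 / \<sigma> - \<tau> * mu_A A"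
  have \<xi>2: "\<xi> \<le> \<xi>2"
    using \<tau> mu_A_le[of A] by (simp add: \<xi>_def \<xi>2_def)
  have pos: "L > 0" "\<xi> > 0" "L + \<mu> > 0" using \<mu> \<xi> by auto
  have g: "gamma_y A \<mu> L \<tau> \<sigma> = (if \<xi> \<ge> (L + \<mu>) / 2
         then 2 * L * \<mu> / (L + \<mu>) + \<mu>\<^sup>2 * (2 * \<xi> - L - \<mu>) / ((L + \<mu>) * \<xi>2)
         else 2 * L * \<mu> / (L + \<mu>) - L\<^sup>2 * (L + \<mu> - 2 * \<xi>) / ((L + \<mu>) * \<xi>))"
    by (simp add: gamma_y_def Let_def \<xi>_def \<xi>2_def)
  have key: "2 * L * \<mu> / (L + \<mu>) * B + H * ((2 * \<xi> - L - \<mu>) / ((L + \<mu>) * \<xi>)) \<le> 2 * c - H / \<xi>"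
  proof -
    have eq: "(2 * \<xi> - L - \<mu>) / ((L + \<mu>) * \<xi>) = 2 / (L + \<mu>) - 1 / \<xi>"
      using pos by (simp add: field_simps)
    have "2 * L * \<mu> / (L + \<mu>) * B + H * ((2 * \<xi> - L - \<mu>) / ((L + \<mu>) * \<xi>))
        = 2 * (L * \<mu> / (L + \<mu>) * B + H / (L + \<mu>)) - H / \<xi>"
      unfolding eq by (simp add: right_diff_distrib distrib_left mult_ac)
    then show ?thesis using c by simp
  qed
  show "gamma_y A \<mu> L \<tau> \<sigma> * B \<le> 2 * c - H / \<xi>"
  proof (cases "\<xi> \<ge> (L + \<mu>) / 2")
    case True
    have n: "0 \<le> 2 * \<xi> - L - \<mu>" using True by simp
    have H0: "0 \<le> H"
      using H(1) B by (intro order_trans[OF _ H(1)]) simp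
    have "\<mu>\<^sup>2 * B * ((2 * \<xi> - L - \<mu>) / ((L + \<mu>) * \<xi>2)) \<le> H * ((2 * \<xi> - L - \<mu>) / ((L + \<mu>) * \<xi>))"
    proof (intro mult_mono)
      show "(2 * \<xi> - L - \<mu>) / ((L + \<mu>) * \<xi>2) \<le> (2 * \<xi> - L - \<mu>) / ((L + \<mu>) * \<xi>)"
        using n pos \<xi>2 by (intro divide_left_mono mult_left_mono mult_pos_pos) auto
    qed (use H H0 n pos \<xi>2 in auto)
    then show ?thesis
      using key True by (simp add: g algebra_simps)
  next
    case False
    then have "(2 * \<xi> - L - \<mu>) / ((L + \<mu>) * \<xi>) \<le> 0"
      using pos by (simp add: divide_le_0_iff)
    then have "L\<^sup>2 * B * ((2 * \<xi> - L - \<mu>) / ((L + \<mu>) * \<xi>)) \<le> H * ((2 * \<xi> - L - \<mu>) / ((L + \<mu>) * \<xi>))"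
      using H(2) by (intro mult_right_mono_neg)
    moreover have "gamma_y A \<mu> L \<tau> \<sigma> = 2 * L * \<mu> / (L + \<mu>) + L\<^sup>2 * ((2 * \<xi> - L - \<mu>) / ((L + \<mu>) * \<xi>))"
    proof -
      have "L + \<mu> - 2 * \<xi> = - (2 * \<xi> - L - \<mu>)" by simp
      then show ?thesis
        unfolding g using False by (simp only: if_False mult_minus_right minus_divide_left[symmetric]
            diff_minus_eq_add times_divide_eq_right)
    qed
    ultimately show ?thesis
      using key by (simp add: algebra_simps)
  qed
  show "0 < gamma_y A \<mu> L \<tau> \<sigma>"
  proof (cases "\<xi> \<ge> (L + \<mu>) / 2")
    case True
    then have "0 \<le> \<mu>\<^sup>2 * (2 * \<xi> - L - \<mu>) / ((L + \<mu>) * \<xi>2)"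
      using pos \<xi>2 by (intro divide_nonneg_pos mult_nonneg_nonneg mult_pos_pos) auto
    then show ?thesis
      using True pos \<mu> by (simp add: g add_pos_nonneg)
  next
    case False
    \<comment> \<open>With \<open>s = L + \<mu>\<close> the second branch collapses to an expression
      free of \<open>\<mu>\<close>, positive because \<open>L / 2 < \<xi>\<close> is strict.\<close>
    have "2 * L * (s - L) / s - L\<^sup>2 * (s - 2 * \<xi>) / (s * \<xi>) = L * (2 * \<xi> - L) / \<xi>" if "s > 0" for s
      using that pos by (simp add: field_simps power2_eq_square)
    from this[of "L + \<mu>"] have "2 * L * \<mu> / (L + \<mu>) - L\<^sup>2 * (L + \<mu> - 2 * \<xi>) / ((L + \<mu>) * \<xi>)
        = L * (2 * \<xi> - L) / \<xi>"
      using pos by simp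
    also have "\<dots> > 0" using pos \<xi> by simp
    finally show ?thesis using False by (simp add: g)
  qed
qed

section \<open>Contraction\<close>

text \<open>The gain in \<open>x\<close> appears at the new point and the gain in \<open>y\<close>
  at the old one. Adding \<open>\<gamma>x\<close> to the first block only, as in \<open>Psi\<close>,
  puts the \<open>x\<close> gain into the norm; the remaining decrease is then compared with the
  whole form.\<close>

lemma sipd_contractive_strong:
  fixes A :: "real^'n^'m"
  assumes f: "proper_fun f" "convex_fun f" "closed_fun f" and scf: "strongly_convex_fun \<mu>f f" "0 \<le> \<mu>f"
    and sm: "smooth_fun L (\<lambda>y. ereal (g y))" and scg: "strongly_convex_fun \<mu>g (\<lambda>y. ereal (g y))" "0 < \<mu>g"
    and \<tau>: "\<tau> > 0" and \<sigma>: "\<sigma> > 0" and cond: "\<tau> * \<sigma> * (spectral_norm A)\<^sup>2 + L / 2 * \<sigma> < 1"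
    and \<gamma>: "0 < gamma_x A \<mu>f \<tau> \<sigma>"
  shows "pos_def_op (Psi A \<mu>f \<tau> \<sigma>)"
    and "rate_strong A \<mu>f \<mu>g L \<tau> \<sigma> < 1"
    and "contractive_in (Psi A \<mu>f \<tau> \<sigma>) (rate_strong A \<mu>f \<mu>g L \<tau> \<sigma>) (sipd_step f g A \<tau> \<sigma>)"
proof -
  define \<xi> where "\<xi> = 1 / \<sigma> - \<tau> * (spectral_norm A)\<^sup>2"
  define \<gamma>x where "\<gamma>x = gamma_x A \<mu>f \<tau> \<sigma>"
  define \<gamma>y where "\<gamma>y = gamma_y A \<mu>g L \<tau> \<sigma>"
  define \<zeta> where "\<zeta> = zeta A \<tau> \<sigma>"
  define c where "c = 1 - min \<gamma>x \<gamma>y / (\<zeta> + \<gamma>x)"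
  have \<mu>L: "\<mu>g \<le> L" by (rule strong_convexity_modulus_le_smoothness[OF sm scg(1)])
  then have L: "L > 0" using scg(2) by simp
  have \<xi>: "L / 2 < \<xi>"
  proof -
    have "(\<tau> * (spectral_norm A)\<^sup>2 + L / 2) * \<sigma> < 1" using cond by (simp add: algebra_simps)
    then have "\<tau> * (spectral_norm A)\<^sup>2 + L / 2 < 1 / \<sigma>" using \<sigma> by (simp add: pos_less_divide_eq)
    then show ?thesis by (simp add: \<xi>_def)
  qed
  then have \<xi>0: "1 / \<sigma> - \<tau> * (spectral_norm A)\<^sup>2 > 0" using L by (simp add: \<xi>_def)
  have \<zeta>: "\<zeta> > 0" unfolding \<zeta>_def by (rule zeta_pos[OF \<tau>])
  have \<gamma>x: "\<gamma>x > 0" using \<gamma> by (simp add: \<gamma>x_def)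
  have \<gamma>y: "\<gamma>y > 0"
    \<comment> \<open>Positivity of \<open>\<gamma>y\<close> does not involve \<open>B\<close>,
      \<open>H\<close> or \<open>c\<close>, and zeros satisfy their hypotheses.\<close>
    unfolding \<gamma>y_def using gamma_y_bound(2)[OF \<tau> scg(2) \<mu>L \<xi>[unfolded \<xi>_def], of 0 0 0] by simp
  have rate: "rate_strong A \<mu>f \<mu>g L \<tau> \<sigma> = sqrt c"
    by (simp add: rate_strong_def c_def \<gamma>x_def \<gamma>y_def \<zeta>_def)
  have c: "0 \<le> c" "c < 1"
    using \<gamma>x \<gamma>y \<zeta> by (auto simp: c_def pos_divide_le_eq)
  show "rate_strong A \<mu>f \<mu>g L \<tau> \<sigma> < 1" using c by (simp add: rate)
  show pd: "pos_def_op (Psi A \<mu>f \<tau> \<sigma>)"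
    using \<gamma> by (intro pos_def_Psi \<tau> \<xi>0) simp
  show "contractive_in (Psi A \<mu>f \<tau> \<sigma>) (rate_strong A \<mu>f \<mu>g L \<tau> \<sigma>) (sipd_step f g A \<tau> \<sigma>)"
    unfolding rate
  proof (rule contractive_in_sqrt[OF pd c])
    fix w w' :: "(real^'n) \<times> (real^'m)"
    obtain x1 y1 x2 y2 where w: "w = (x1, y1)" "w' = (x2, y2)" by fastforce
    obtain x1' y1' where step1: "sipd_step f g A \<tau> \<sigma> (x1, y1) = (x1', y1')" by fastforce
    obtain x2' y2' where step2: "sipd_step f g A \<tau> \<sigma> (x2, y2) = (x2', y2')" by fastforce
    let ?Q = "\<lambda>w. w \<bullet> Phi A \<tau> \<sigma> w"
    have Psi: "(u, v) \<bullet> Psi A \<mu>f \<tau> \<sigma> (u, v) = ?Q (u, v) + \<gamma>x * (norm u)\<^sup>2" for u v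
      by (simp add: Psi_apply inner_add_right power2_norm_eq_inner \<gamma>x_def)
    define a b a' b' where "a = x1 - x2" and "b = y1 - y2" and "a' = x1' - x2'" and "b' = y1' - y2'"
    define h where "h = gradient g y1 - gradient g y2"
    define p where "p = ((1 / \<tau>) *\<^sub>R (x1 - x1') - y1 v* A) - ((1 / \<tau>) *\<^sub>R (x2 - x2') - y2 v* A)"
    have descent: "?Q (a', b') + ((norm (p + b' v* A))\<^sup>2 + (norm (A *v a'))\<^sup>2) / \<zeta>
        + 2 * \<mu>f * (norm a')\<^sup>2 + 2 * (h \<bullet> b) \<le> ?Q (a, b) + (norm h)\<^sup>2 / \<xi>"
      unfolding a_def b_def a'_def b'_def h_def p_def \<xi>_def \<zeta>_def
      by (rule sipd_step_descent[OF f scf(1) \<tau> \<sigma> \<xi>0 step1 step2])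
    have gy: "\<gamma>y * (norm b)\<^sup>2 \<le> 2 * (h \<bullet> b) - (norm h)\<^sup>2 / \<xi>"
      unfolding \<gamma>y_def \<xi>_def
    proof (rule gamma_y_bound(1)[OF \<tau> scg(2) \<mu>L \<xi>[unfolded \<xi>_def]])
      have "(\<mu>g * norm b)\<^sup>2 \<le> (norm h)\<^sup>2"
        using gradient_strongly_monotone_cocoercive(2)[OF sm scg(1) _ L, of y1 y2] scg(2)
        by (intro power_mono) (auto simp: h_def b_def)
      then show "\<mu>g\<^sup>2 * (norm b)\<^sup>2 \<le> (norm h)\<^sup>2" by (simp add: power_mult_distrib)
      have "(norm h)\<^sup>2 \<le> (L * norm b)\<^sup>2"
        using smooth_fun_gradient(2)[OF sm, of y1 y2] by (intro power_mono) (auto simp: h_def b_def)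
      then show "(norm h)\<^sup>2 \<le> L\<^sup>2 * (norm b)\<^sup>2" by (simp add: power_mult_distrib)
      show "L * \<mu>g / (L + \<mu>g) * (norm b)\<^sup>2 + (norm h)\<^sup>2 / (L + \<mu>g) \<le> h \<bullet> b"
        using gradient_strongly_monotone_cocoercive(1)[OF sm scg(1) _ L, of y1 y2] scg(2)
        by (simp add: h_def b_def)
    qed simp
    \<comment> \<open>Of the two squared residuals only the \<open>A *v a'\<close> part is kept; it
      supplies the first summand of \<open>\<gamma>x\<close>.\<close>
    have "mu_A A * (norm a')\<^sup>2 \<le> (norm (p + b' v* A))\<^sup>2 + (norm (A *v a'))\<^sup>2"
      using lambda_min_gram(1)[of A a'] zero_le_power2[of "norm (p + b' v* A)"]
      unfolding mu_A_def by linarith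
    then have "mu_A A * (norm a')\<^sup>2 / \<zeta> \<le> ((norm (p + b' v* A))\<^sup>2 + (norm (A *v a'))\<^sup>2) / \<zeta>"
      using \<zeta> by (intro divide_right_mono) auto
    moreover have "\<gamma>x * (norm a')\<^sup>2 = mu_A A * (norm a')\<^sup>2 / \<zeta> + 2 * \<mu>f * (norm a')\<^sup>2"
      by (simp add: \<gamma>x_def gamma_x_def \<zeta>_def algebra_simps)
    ultimately have 1: "?Q (a', b') + \<gamma>x * (norm a')\<^sup>2 \<le> ?Q (a, b) - \<gamma>y * (norm b)\<^sup>2"
      using descent gy by linarith
    \<comment> \<open>\<open>R\<close> is the \<open>Psi\<close> form of the old difference and is
      at most \<open>(\<zeta> + \<gamma>x) * N\<close>. Hence the gain, at least
      \<open>min \<gamma>x \<gamma>y * N\<close>, is a fixed fraction of \<open>R\<close>.\<close>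
    define N where "N = (norm a)\<^sup>2 + (norm b)\<^sup>2"
    define R where "R = ?Q (a, b) + \<gamma>x * (norm a)\<^sup>2"
    have "?Q (a, b) \<le> \<zeta> * N"
      using Phi_quadratic_le[OF \<tau> \<sigma>, of "(a, b)" A] by (simp add: \<zeta>_def N_def norm_Pair)
    moreover have "\<gamma>x * (norm a)\<^sup>2 \<le> \<gamma>x * N"
      using \<gamma>x by (simp add: N_def)
    ultimately have "R \<le> (\<zeta> + \<gamma>x) * N" unfolding R_def distrib_right by linarith
    then have "R / (\<zeta> + \<gamma>x) \<le> N" using \<zeta> \<gamma>x by (simp add: pos_divide_le_eq mult.commute)
    then have "min \<gamma>x \<gamma>y * (R / (\<zeta> + \<gamma>x)) \<le> min \<gamma>x \<gamma>y * N"
      using \<gamma>x \<gamma>y by (intro mult_left_mono) auto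
    also have "\<dots> \<le> \<gamma>x * (norm a)\<^sup>2 + \<gamma>y * (norm b)\<^sup>2"
      unfolding N_def distrib_left by (intro add_mono mult_right_mono) auto
    finally have "R - \<gamma>x * (norm a)\<^sup>2 - \<gamma>y * (norm b)\<^sup>2 \<le> c * R"
      by (simp add: c_def left_diff_distrib)
    with 1 have "?Q (a', b') + \<gamma>x * (norm a')\<^sup>2 \<le> c * R"
      unfolding R_def by linarith
    then show "(sipd_step f g A \<tau> \<sigma> w - sipd_step f g A \<tau> \<sigma> w') \<bullet>
        Psi A \<mu>f \<tau> \<sigma> (sipd_step f g A \<tau> \<sigma> w - sipd_step f g A \<tau> \<sigma> w')
      \<le> c * ((w - w') \<bullet> Psi A \<mu>f \<tau> \<sigma> (w - w'))"
      unfolding w step1 step2 diff_Pair Psi R_def a_def b_def a'_def b'_def .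
  qed
qed

text \<open>\<open>R\<^sup>2\<close> is the constant of an error bound: the squared norms of
  \<open>a'\<close> and \<open>b'\<close> sum to at most \<open>R\<^sup>2 * S\<close>. Here
  \<open>a'\<close> contributes \<open>1 / \<kappa>\<close>, while \<open>b' v* A\<close> is split
  into the residual and the gradient difference of \<open>f\<close>, which contribute
  \<open>2 / \<kappa>\<close> and \<open>2 * Lf\<^sup>2 / \<kappa>\<^sup>2\<close>. No step size
  enters.\<close>

lemma sipd_contractive_smooth:
  fixes A :: "real^'n^'m" and Lf :: real
  defines "\<kappa> \<equiv> lambda_min (transpose A ** A)"
  defines "R \<equiv> sqrt (3 / \<kappa> + 2 * Lf\<^sup>2 / \<kappa>\<^sup>2)"
  assumes f: "proper_fun f" "convex_fun f" "closed_fun f" and smf: "smooth_fun Lf f"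
    and sm: "smooth_fun L (\<lambda>y. ereal (g y))" and cv: "convex_fun (\<lambda>y. ereal (g y))"
    and \<kappa>: "\<kappa> > 0" "\<kappa> = lambda_min (A ** transpose A)"
    and \<tau>: "\<tau> > 0" and \<sigma>: "\<sigma> > 0" and cond: "\<tau> * \<sigma> * (spectral_norm A)\<^sup>2 + L / 2 * \<sigma> \<le> 1"
    and strict: "\<tau> * \<sigma> * (spectral_norm A)\<^sup>2 < 1"
  shows "rate_smooth R A \<tau> \<sigma> < 1"
    and "contractive_in (Phi A \<tau> \<sigma>) (rate_smooth R A \<tau> \<sigma>) (sipd_step f g A \<tau> \<sigma>)"
proof -
  define \<xi> where "\<xi> = 1 / \<sigma> - \<tau> * (spectral_norm A)\<^sup>2"
  define \<zeta> where "\<zeta> = zeta A \<tau> \<sigma>"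
  define r where "r = R\<^sup>2 * \<zeta>\<^sup>2"
  define c where "c = r / (r + 1)"
  have \<xi>: "L / 2 \<le> \<xi>"
  proof -
    have "(\<tau> * (spectral_norm A)\<^sup>2 + L / 2) * \<sigma> \<le> 1" using cond by (simp add: algebra_simps)
    then have "\<tau> * (spectral_norm A)\<^sup>2 + L / 2 \<le> 1 / \<sigma>" using \<sigma> by (simp add: pos_le_divide_eq)
    then show ?thesis by (simp add: \<xi>_def)
  qed
  \<comment> \<open>For \<open>L = 0\<close> the nonstrict condition alone would allow
    \<open>\<xi> = 0\<close>, so the strict one is used.\<close>
  have \<xi>0: "1 / \<sigma> - \<tau> * (spectral_norm A)\<^sup>2 > 0"
    using strict \<sigma> by (simp add: pos_less_divide_eq mult_ac)
  have \<zeta>: "\<zeta> > 0" unfolding \<zeta>_def by (rule zeta_pos[OF \<tau>])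
  have R2: "R\<^sup>2 = 3 / \<kappa> + 2 * Lf\<^sup>2 / \<kappa>\<^sup>2" and R: "R > 0"
    using \<kappa>(1) by (simp_all add: R_def add_pos_nonneg)
  have r: "r > 0" using R \<zeta> by (simp add: r_def)
  have rate: "rate_smooth R A \<tau> \<sigma> = sqrt c"
    using R \<zeta> by (simp add: rate_smooth_def c_def r_def \<zeta>_def real_sqrt_divide real_sqrt_mult)
  have c: "0 \<le> c" "c < 1" using r by (auto simp: c_def)
  show "rate_smooth R A \<tau> \<sigma> < 1" using c by (simp add: rate)
  show "contractive_in (Phi A \<tau> \<sigma>) (rate_smooth R A \<tau> \<sigma>) (sipd_step f g A \<tau> \<sigma>)"
    unfolding rate
  proof (rule contractive_in_sqrt[OF pos_def_Phi[OF \<tau> \<xi>0] c])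
    fix w w' :: "(real^'n) \<times> (real^'m)"
    obtain x1 y1 x2 y2 where w: "w = (x1, y1)" "w' = (x2, y2)" by fastforce
    obtain x1' y1' where step1: "sipd_step f g A \<tau> \<sigma> (x1, y1) = (x1', y1')" by fastforce
    obtain x2' y2' where step2: "sipd_step f g A \<tau> \<sigma> (x2, y2) = (x2', y2')" by fastforce
    let ?Q = "\<lambda>w. w \<bullet> Phi A \<tau> \<sigma> w"
    have sc: "strongly_convex_fun 0 f"
      using f(2) by (simp add: convex_fun_eq_strongly_convex)
    define a b a' b' where "a = x1 - x2" and "b = y1 - y2" and "a' = x1' - x2'" and "b' = y1' - y2'"
    define h where "h = gradient g y1 - gradient g y2"
    define s1 where "s1 = (1 / \<tau>) *\<^sub>R (x1 - x1') - y1 v* A"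
    define s2 where "s2 = (1 / \<tau>) *\<^sub>R (x2 - x2') - y2 v* A"
    define S where "S = (norm ((s1 - s2) + b' v* A))\<^sup>2 + (norm (A *v a'))\<^sup>2"
    have "?Q (a', b') + S / \<zeta> + 2 * 0 * (norm a')\<^sup>2 + 2 * (h \<bullet> b) \<le> ?Q (a, b) + (norm h)\<^sup>2 / \<xi>"
      unfolding a_def b_def a'_def b'_def h_def s1_def s2_def \<xi>_def \<zeta>_def S_def
      by (rule sipd_step_descent[OF f sc \<tau> \<sigma> \<xi>0 step1 step2])
    moreover have "(norm h)\<^sup>2 / \<xi> \<le> 2 * (h \<bullet> b)"
      unfolding h_def b_def using \<xi>0 by (intro gradient_cocoercive[OF sm cv \<xi>]) (simp add: \<xi>_def)
    ultimately have 1: "?Q (a', b') + S / \<zeta> \<le> ?Q (a, b)" by simp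
    have "f x \<noteq> \<infinity>" for x
      using smf unfolding smooth_fun_def by (metis abs_ereal.simps(3))
    then have dom: "effective_domain f = UNIV"
      by (auto simp: effective_domain_def less_top[symmetric] top_ereal_def)
    let ?F = "\<lambda>x. real_of_ereal (f x)"
    \<comment> \<open>Differentiability identifies the subgradient chosen by the prox with the
      gradient at the new point, so its Lipschitz bound controls \<open>s1 - s2\<close> by
      \<open>a'\<close>.\<close>
    have "gradient ?F x1' = s1"
      using sipd_step_subgradient(2)[OF f sc \<tau> step1] dom
      by (intro subgradient_eq_gradient[OF smooth_fun_gradient(1)[OF smf]]) (simp add: s1_def)
    moreover have "gradient ?F x2' = s2"
      using sipd_step_subgradient(2)[OF f sc \<tau> step2] dom
      by (intro subgradient_eq_gradient[OF smooth_fun_gradient(1)[OF smf]]) (simp add: s2_def)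
    ultimately have s: "norm (s1 - s2) \<le> Lf * norm a'"
      using smooth_fun_gradient(2)[OF smf, of x1' x2'] by (simp add: a'_def)
    have gram: "\<kappa> * (norm a')\<^sup>2 \<le> (norm (A *v a'))\<^sup>2" "\<kappa> * (norm b')\<^sup>2 \<le> (norm (b' v* A))\<^sup>2"
      using lambda_min_gram(1)[of A a'] lambda_min_gram(2)[of A b'] \<kappa>(2) by (simp_all add: \<kappa>_def)
    have "norm (b' v* A) \<le> norm ((s1 - s2) + b' v* A) + norm (s1 - s2)"
      using norm_triangle_ineq4[of "(s1 - s2) + b' v* A" "s1 - s2"] by simp
    with s have "norm (b' v* A) \<le> norm ((s1 - s2) + b' v* A) + Lf * norm a'" by linarith
    then have "(norm (b' v* A))\<^sup>2 \<le> (norm ((s1 - s2) + b' v* A) + Lf * norm a')\<^sup>2"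
      by (intro power_mono) auto
    also have "\<dots> \<le> 2 * (norm ((s1 - s2) + b' v* A))\<^sup>2 + 2 * (Lf * norm a')\<^sup>2"
      using sum_squares_bound[of "norm ((s1 - s2) + b' v* A)" "Lf * norm a'"] by (simp add: power2_sum)
    also have "\<dots> \<le> 2 * S + 2 * Lf\<^sup>2 * (norm a')\<^sup>2"
      by (simp add: S_def power_mult_distrib)
    finally have 2: "\<kappa> * (norm b')\<^sup>2 \<le> 2 * S + 2 * Lf\<^sup>2 * (norm a')\<^sup>2" using gram(2) by linarith
    have "\<kappa> * (norm a')\<^sup>2 \<le> S"
      using gram(1) zero_le_power2[of "norm ((s1 - s2) + b' v* A)"] unfolding S_def by linarith
    then have a': "(norm a')\<^sup>2 \<le> S / \<kappa>" using \<kappa>(1) by (simp add: pos_le_divide_eq mult.commute)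
    have "(norm b')\<^sup>2 \<le> (2 * S + 2 * Lf\<^sup>2 * (norm a')\<^sup>2) / \<kappa>"
      using 2 \<kappa>(1) by (simp add: pos_le_divide_eq mult.commute)
    also have "\<dots> \<le> (2 * S + 2 * Lf\<^sup>2 * (S / \<kappa>)) / \<kappa>"
      using a' \<kappa>(1) by (intro divide_right_mono add_left_mono mult_left_mono) auto
    finally have "(norm a')\<^sup>2 + (norm b')\<^sup>2 \<le> S / \<kappa> + (2 * S + 2 * Lf\<^sup>2 * (S / \<kappa>)) / \<kappa>"
      using a' by linarith
    also have "\<dots> = R\<^sup>2 * S"
      unfolding R2 using \<kappa>(1) by (simp add: field_simps power2_eq_square)
    \<comment> \<open>The new form is now at most \<open>r\<close> times the decrease
      \<open>S / \<zeta>\<close>; solving for it gives the factor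
      \<open>r / (r + 1)\<close>.\<close>
    finally have "\<zeta> * ((norm a')\<^sup>2 + (norm b')\<^sup>2) \<le> \<zeta> * (R\<^sup>2 * S)"
      using \<zeta> by (intro mult_left_mono) auto
    then have "?Q (a', b') \<le> \<zeta> * (R\<^sup>2 * S)"
      using Phi_quadratic_le[OF \<tau> \<sigma>, of "(a', b')" A] by (simp add: \<zeta>_def norm_Pair)
    also have "\<dots> = r * (S / \<zeta>)"
      using \<zeta> by (simp add: r_def power2_eq_square)
    also have "\<dots> \<le> r * (?Q (a, b) - ?Q (a', b'))"
      using 1 r by (intro mult_left_mono) auto
    finally have "?Q (a', b') * (r + 1) \<le> r * ?Q (a, b)" by (simp add: algebra_simps)
    then have "?Q (a', b') \<le> c * ?Q (a, b)"
      using r by (simp add: c_def pos_le_divide_eq)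
    then show "(sipd_step f g A \<tau> \<sigma> w - sipd_step f g A \<tau> \<sigma> w') \<bullet>
        Phi A \<tau> \<sigma> (sipd_step f g A \<tau> \<sigma> w - sipd_step f g A \<tau> \<sigma> w')
      \<le> c * ((w - w') \<bullet> Phi A \<tau> \<sigma> (w - w'))"
      unfolding w step1 step2 diff_Pair a_def b_def a'_def b'_def .
  qed
qed

section \<open>Optimal step sizes\<close>

text \<open>Lowering both step sizes to their minimum preserves the constraints, so equal steps
  \<open>t\<close> decide. The first constraint then reads \<open>q t \<le> 1\<close>, where
  \<open>q\<close> increases and \<open>t0\<close> is its positive root of \<open>q t = 1\<close>;
  the second reads \<open>t \<le> t1\<close>.\<close>

lemma best_step_optimal:
  fixes A :: "real^'n^'m"
  assumes N: "spectral_norm A > 0" and L: "0 \<le> L" and \<epsilon>: "\<epsilon> > 0"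
  shows "admissible_smooth A L \<epsilon> (best_step A L \<epsilon>) (best_step A L \<epsilon>)"
    and "admissible_smooth A L \<epsilon> \<tau> \<sigma> \<Longrightarrow> min \<tau> \<sigma> \<le> best_step A L \<epsilon>"
proof -
  define N where "N = spectral_norm A"
  have N: "N > 0" using N by (simp add: N_def)
  define D where "D = sqrt (L\<^sup>2 + 16 * N\<^sup>2)"
  define t0 where "t0 = (D - L) / (4 * N\<^sup>2)"
  define t1 where "t1 = 1 / ((1 + \<epsilon>) * N)"
  define q where "q t = t * t * N\<^sup>2 + L / 2 * t" for t
  have D2: "D\<^sup>2 = L\<^sup>2 + 16 * N\<^sup>2" by (simp add: D_def)
  have "L < D" unfolding D_def by (rule real_less_rsqrt) (use N in simp)
  then have t0: "t0 > 0" using N by (simp add: t0_def)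
  have t1: "t1 > 0" using N \<epsilon> by (simp add: t1_def)
  have best: "best_step A L \<epsilon> = min t0 t1"
    by (simp add: best_step_def t0_def t1_def D_def N_def)
  have q0: "q t0 = 1"
  proof -
    have "q t0 = ((D - L)\<^sup>2 + 2 * L * (D - L)) / (16 * N\<^sup>2)"
      using N by (simp add: q_def t0_def field_simps power2_eq_square)
    also have "(D - L)\<^sup>2 + 2 * L * (D - L) = 16 * N\<^sup>2"
      using D2 by (simp add: power2_eq_square algebra_simps)
    finally show ?thesis using N by simp
  qed
  have q_mono: "q s \<le> q t" if "0 \<le> s" "s \<le> t" for s t
    unfolding q_def using that L by (intro add_mono mult_mono) auto
  have sq: "t * t * N\<^sup>2 * (1 + \<epsilon>)\<^sup>2 = (t * ((1 + \<epsilon>) * N))\<^sup>2" for t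
    by (simp add: power2_eq_square mult_ac)
  show "admissible_smooth A L \<epsilon> (best_step A L \<epsilon>) (best_step A L \<epsilon>)"
  proof -
    define t where "t = min t0 t1"
    have t: "t > 0" "t \<le> t0" "t \<le> t1" using t0 t1 by (auto simp: t_def)
    have "q t \<le> 1" using q_mono[of t t0] t q0 by simp
    moreover have "t * ((1 + \<epsilon>) * N) \<le> 1"
      using t(3) N \<epsilon> by (simp add: t1_def pos_le_divide_eq)
    then have "(t * ((1 + \<epsilon>) * N))\<^sup>2 \<le> 1"
      using t N \<epsilon> by (intro power_le_one) auto
    ultimately show ?thesis
      unfolding best t_def[symmetric] admissible_smooth_def N_def[symmetric]
      using t(1) sq[of t] by (simp add: q_def)
  qed
  assume adm: "admissible_smooth A L \<epsilon> \<tau> \<sigma>"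
  define t where "t = min \<tau> \<sigma>"
  have t: "t > 0" "t \<le> \<tau>" "t \<le> \<sigma>" using adm by (auto simp: t_def admissible_smooth_def)
  have tt: "t * t * N\<^sup>2 \<le> \<tau> * \<sigma> * N\<^sup>2"
    using t by (intro mult_right_mono mult_mono) auto
  have "L / 2 * t \<le> L / 2 * \<sigma>" using t L by (intro mult_left_mono) auto
  with tt have q1: "q t \<le> 1"
    using adm unfolding admissible_smooth_def N_def[symmetric] q_def by linarith
  have "t \<le> t0"
  proof (rule ccontr)
    assume "\<not> t \<le> t0"
    then have "t0 * t0 * N\<^sup>2 < t * t * N\<^sup>2"
      using t0 N by (intro mult_strict_right_mono mult_strict_mono) auto
    moreover have "L / 2 * t0 \<le> L / 2 * t"
      using \<open>\<not> t \<le> t0\<close> L by (intro mult_left_mono) auto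
    ultimately show False using q0 q1 unfolding q_def by linarith
  qed
  moreover have "t \<le> t1"
  proof -
    have "t * t * N\<^sup>2 * (1 + \<epsilon>)\<^sup>2 \<le> \<tau> * \<sigma> * N\<^sup>2 * (1 + \<epsilon>)\<^sup>2"
      by (rule mult_right_mono[OF tt]) simp
    then have "(t * ((1 + \<epsilon>) * N))\<^sup>2 \<le> 1"
      using adm sq[of t] unfolding admissible_smooth_def N_def[symmetric] by linarith
    then have "t * ((1 + \<epsilon>) * N) \<le> 1"
      by (simp add: abs_square_le_1)
    then show ?thesis using N \<epsilon> by (simp add: t1_def pos_le_divide_eq)
  qed
  ultimately show "min \<tau> \<sigma> \<le> best_step A L \<epsilon>" by (simp add: best t_def)
qed

text \<open>Rewritten as the root of \<open>1 - 1 / ((R * \<zeta>)\<^sup>2 + 1)\<close>, the rate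
  visibly increases with \<open>\<zeta>\<close>, and \<open>\<zeta>\<close> depends on the step
  sizes only through the reciprocal of their minimum.\<close>

lemma rate_smooth_antimono:
  assumes R: "R > 0" and t: "t > 0" and pos: "\<tau> > 0" "\<sigma> > 0" and le: "min \<tau> \<sigma> \<le> t"
  shows "rate_smooth R A t t \<le> rate_smooth R A \<tau> \<sigma>"
proof -
  have rate: "rate_smooth R A \<tau> \<sigma> = sqrt (1 - 1 / ((R * zeta A \<tau> \<sigma>)\<^sup>2 + 1))" if "\<tau> > 0" for \<tau> \<sigma>
  proof -
    define r where "r = R * zeta A \<tau> \<sigma>"
    have r: "r > 0"
      unfolding r_def by (intro mult_pos_pos R zeta_pos[OF that])
    have "r\<^sup>2 + 1 > 0" by (simp add: add_nonneg_pos)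
    then have "1 - 1 / (r\<^sup>2 + 1) = r\<^sup>2 / (r\<^sup>2 + 1)" by (simp add: field_simps)
    then have "sqrt (1 - 1 / (r\<^sup>2 + 1)) = r / sqrt (r\<^sup>2 + 1)"
      using r by (simp add: real_sqrt_divide)
    then show ?thesis
      by (simp add: rate_smooth_def r_def power_mult_distrib)
  qed
  have "1 / t \<le> max (1 / \<tau>) (1 / \<sigma>)"
  proof (cases "\<tau> \<le> t")
    case True
    then have "1 / t \<le> 1 / \<tau>" using pos by (intro divide_left_mono) auto
    then show ?thesis by simp
  next
    case False
    then have "1 / t \<le> 1 / \<sigma>" using pos le t by (intro divide_left_mono) (auto simp: min_def split: if_splits)
    then show ?thesis by simp
  qed
  then have "zeta A t t \<le> zeta A \<tau> \<sigma>" by (simp add: zeta_def)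
  then have "(R * zeta A t t)\<^sup>2 \<le> (R * zeta A \<tau> \<sigma>)\<^sup>2"
    using R zeta_pos[OF t, of A t] by (intro power_mono mult_left_mono) auto
  then have "1 / ((R * zeta A \<tau> \<sigma>)\<^sup>2 + 1) \<le> 1 / ((R * zeta A t t)\<^sup>2 + 1)"
    by (intro divide_left_mono mult_pos_pos add_nonneg_pos) auto
  then show ?thesis
    unfolding rate[OF pos(1)] rate[OF t] by simp
qed

theorem theorem3:
  fixes f :: "real^'n \<Rightarrow> ereal" and g :: "real^'m \<Rightarrow> real" and A :: "real^'n^'m"
    and \<mu>f \<mu>g Lf Lg \<epsilon> :: real
  assumes f: "proper_fun f" "convex_fun f" "closed_fun f"
    and g: "proper_fun (\<lambda>y. ereal (g y))" "convex_fun (\<lambda>y. ereal (g y))"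
      "closed_fun (\<lambda>y. ereal (g y))"
    and g_smooth: "smooth_fun Lg (\<lambda>y. ereal (g y))"
    and f_modulus: "\<mu>f \<ge> 0" "strongly_convex_fun \<mu>f f"
    and eps: "\<epsilon> > 0"
  shows
    "(\<forall>\<tau>>0. \<forall>\<sigma>>0. \<forall>x y.
        sipd_step f g A \<tau> \<sigma> (x, y) = (x, y) \<longleftrightarrow> saddle_solution f (\<lambda>y. ereal (g y)) A x y)
     \<and> (\<forall>\<tau>>0. \<forall>\<sigma>>0.
        \<tau> * \<sigma> * (spectral_norm A)\<^sup>2 + Lg / 2 * \<sigma> < 1 \<and> (cond_C1 f g \<mu>f \<mu>g \<or> cond_C2 g A \<mu>g Lg) \<longrightarrow>
          pos_def_op (Psi A \<mu>f \<tau> \<sigma>) \<and>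
          rate_strong A \<mu>f \<mu>g Lg \<tau> \<sigma> < 1 \<and>
          contractive_in (Psi A \<mu>f \<tau> \<sigma>) (rate_strong A \<mu>f \<mu>g Lg \<tau> \<sigma>) (sipd_step f g A \<tau> \<sigma>))
     \<and> (cond_C3 f g A Lf Lg \<longrightarrow>
        (\<exists>R>0.
          (\<forall>\<tau> \<sigma>. admissible_smooth A Lg \<epsilon> \<tau> \<sigma> \<longrightarrow>
             rate_smooth R A \<tau> \<sigma> < 1 \<and>
             contractive_in (Phi A \<tau> \<sigma>) (rate_smooth R A \<tau> \<sigma>) (sipd_step f g A \<tau> \<sigma>)) \<and>
          admissible_smooth A Lg \<epsilon> (best_step A Lg \<epsilon>) (best_step A Lg \<epsilon>) \<and>
          (\<forall>\<tau> \<sigma>. admissible_smooth A Lg \<epsilon> \<tau> \<sigma> \<longrightarrow>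
             rate_smooth R A (best_step A Lg \<epsilon>) (best_step A Lg \<epsilon>) \<le> rate_smooth R A \<tau> \<sigma>)))"
proof (intro conjI)
  show "\<forall>\<tau>>0. \<forall>\<sigma>>0. \<forall>x y.
      sipd_step f g A \<tau> \<sigma> (x, y) = (x, y) \<longleftrightarrow> saddle_solution f (\<lambda>y. ereal (g y)) A x y"
    using sipd_fixed_point_iff_saddle[OF f g(2) g_smooth] by blast
  show "\<forall>\<tau>>0. \<forall>\<sigma>>0.
      \<tau> * \<sigma> * (spectral_norm A)\<^sup>2 + Lg / 2 * \<sigma> < 1 \<and> (cond_C1 f g \<mu>f \<mu>g \<or> cond_C2 g A \<mu>g Lg) \<longrightarrow>
        pos_def_op (Psi A \<mu>f \<tau> \<sigma>) \<and>
        rate_strong A \<mu>f \<mu>g Lg \<tau> \<sigma> < 1 \<and>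
        contractive_in (Psi A \<mu>f \<tau> \<sigma>) (rate_strong A \<mu>f \<mu>g Lg \<tau> \<sigma>) (sipd_step f g A \<tau> \<sigma>)"
  proof (intro allI impI, elim conjE)
    fix \<tau> \<sigma> :: real
    assume \<tau>: "\<tau> > 0" and \<sigma>: "\<sigma> > 0" and cond: "\<tau> * \<sigma> * (spectral_norm A)\<^sup>2 + Lg / 2 * \<sigma> < 1"
      and C: "cond_C1 f g \<mu>f \<mu>g \<or> cond_C2 g A \<mu>g Lg"
    have sc: "strongly_convex_fun \<mu>g (\<lambda>y. ereal (g y))" "0 < \<mu>g"
      using C by (auto simp: cond_C1_def cond_C2_def)
    \<comment> \<open>(C1) makes the \<open>\<mu>f\<close> part of \<open>gamma_x\<close> positive
      and (C2) the \<open>mu_A\<close> part; after that both cases share one contraction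
      argument.\<close>
    have "\<mu>f > 0 \<or> mu_A A > 0"
      using C by (auto simp: cond_C1_def cond_C2_def mu_A_def)
    then have "0 < gamma_x A \<mu>f \<tau> \<sigma>"
      unfolding gamma_x_def using zeta_pos[OF \<tau>, of A \<sigma>] mu_A_nonneg[of A] f_modulus(1)
      by (auto intro: add_pos_nonneg add_nonneg_pos)
    note R = sipd_contractive_strong[OF f f_modulus(2,1) g_smooth sc \<tau> \<sigma> cond this]
    show "pos_def_op (Psi A \<mu>f \<tau> \<sigma>) \<and>
        rate_strong A \<mu>f \<mu>g Lg \<tau> \<sigma> < 1 \<and>
        contractive_in (Psi A \<mu>f \<tau> \<sigma>) (rate_strong A \<mu>f \<mu>g Lg \<tau> \<sigma>) (sipd_step f g A \<tau> \<sigma>)"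
      using R by blast
  qed
  show "cond_C3 f g A Lf Lg \<longrightarrow>
        (\<exists>R>0.
          (\<forall>\<tau> \<sigma>. admissible_smooth A Lg \<epsilon> \<tau> \<sigma> \<longrightarrow>
             rate_smooth R A \<tau> \<sigma> < 1 \<and>
             contractive_in (Phi A \<tau> \<sigma>) (rate_smooth R A \<tau> \<sigma>) (sipd_step f g A \<tau> \<sigma>)) \<and>
          admissible_smooth A Lg \<epsilon> (best_step A Lg \<epsilon>) (best_step A Lg \<epsilon>) \<and>
          (\<forall>\<tau> \<sigma>. admissible_smooth A Lg \<epsilon> \<tau> \<sigma> \<longrightarrow>
             rate_smooth R A (best_step A Lg \<epsilon>) (best_step A Lg \<epsilon>) \<le> rate_smooth R A \<tau> \<sigma>))"
  proof
    assume C: "cond_C3 f g A Lf Lg"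
    define \<kappa> where "\<kappa> = lambda_min (transpose A ** A)"
    have \<kappa>: "\<kappa> > 0" "\<kappa> = lambda_min (A ** transpose A)" and smf: "smooth_fun Lf f" and Lg: "0 \<le> Lg"
      using C by (simp_all add: cond_C3_def \<kappa>_def)
    \<comment> \<open>The constant is fixed before any step sizes are introduced, which is the
      claimed independence of \<open>\<sigma>\<close> and \<open>\<tau>\<close>.\<close>
    define R where "R = sqrt (3 / \<kappa> + 2 * Lf\<^sup>2 / \<kappa>\<^sup>2)"
    have R: "R > 0" using \<kappa>(1) by (simp add: R_def add_pos_nonneg)
    \<comment> \<open>A positive smallest eigenvalue rules out \<open>A = 0\<close>, so the
      divisions in \<open>best_step\<close> are genuine.\<close>
    have "0 < (spectral_norm A)\<^sup>2"
      using mu_A_le[of A] \<kappa>(1) unfolding mu_A_def \<kappa>_def by linarith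
    then have N: "spectral_norm A > 0"
      using spectral_norm_nonneg[of A] by (cases "spectral_norm A = 0") auto
    note best = best_step_optimal[OF N Lg eps]
    show "\<exists>R>0.
          (\<forall>\<tau> \<sigma>. admissible_smooth A Lg \<epsilon> \<tau> \<sigma> \<longrightarrow>
             rate_smooth R A \<tau> \<sigma> < 1 \<and>
             contractive_in (Phi A \<tau> \<sigma>) (rate_smooth R A \<tau> \<sigma>) (sipd_step f g A \<tau> \<sigma>)) \<and>
          admissible_smooth A Lg \<epsilon> (best_step A Lg \<epsilon>) (best_step A Lg \<epsilon>) \<and>
          (\<forall>\<tau> \<sigma>. admissible_smooth A Lg \<epsilon> \<tau> \<sigma> \<longrightarrow>
             rate_smooth R A (best_step A Lg \<epsilon>) (best_step A Lg \<epsilon>) \<le> rate_smooth R A \<tau> \<sigma>)"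
    proof (intro exI[of _ R] conjI allI impI R best(1))
      fix \<tau> \<sigma> assume adm: "admissible_smooth A Lg \<epsilon> \<tau> \<sigma>"
      then have pos: "\<tau> > 0" "\<sigma> > 0"
        and cond: "\<tau> * \<sigma> * (spectral_norm A)\<^sup>2 + Lg / 2 * \<sigma> \<le> 1"
        and margin: "\<tau> * \<sigma> * (spectral_norm A)\<^sup>2 * (1 + \<epsilon>)\<^sup>2 \<le> 1"
        by (simp_all add: admissible_smooth_def)
      have "0 < \<tau> * \<sigma> * (spectral_norm A)\<^sup>2" using pos N by simp
      \<comment> \<open>The margin \<open>\<epsilon>\<close> turns the second step-size condition
        into the strict inequality that makes \<open>Phi\<close> positive definite.\<close>
      moreover have "1 < (1 + \<epsilon>)\<^sup>2" using eps by (simp add: one_less_power)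
      ultimately have "\<tau> * \<sigma> * (spectral_norm A)\<^sup>2 * 1 < \<tau> * \<sigma> * (spectral_norm A)\<^sup>2 * (1 + \<epsilon>)\<^sup>2"
        by (intro mult_strict_left_mono)
      then have strict: "\<tau> * \<sigma> * (spectral_norm A)\<^sup>2 < 1" using margin by simp
      note S = sipd_contractive_smooth[OF f smf g_smooth g(2) \<kappa>[unfolded \<kappa>_def] pos cond strict,
          folded \<kappa>_def, folded R_def]
      show "rate_smooth R A \<tau> \<sigma> < 1"
        and "contractive_in (Phi A \<tau> \<sigma>) (rate_smooth R A \<tau> \<sigma>) (sipd_step f g A \<tau> \<sigma>)"
        by (rule S)+
      show "rate_smooth R A (best_step A Lg \<epsilon>) (best_step A Lg \<epsilon>) \<le> rate_smooth R A \<tau> \<sigma>"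
        using best(1) pos by (intro rate_smooth_antimono R best(2)[OF adm]) (simp_all add: admissible_smooth_def)
    qed
  qed
qed

end
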